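(* Let $p$ be a prime, let $m$ be a positive integer with $\gcd(p,m)=1$, let $k$ be a nonnegative integer, and let $n=p^km$ (with $n\geq 2$). Then, in $\mathbb{Z}_p[x]$: (i) if $m=1$ (so $k\ge1$), $\Psi_n(x)\equiv(x^2+4)^{\varphi(p^k)/2}$ (for $p=2$, $k=1$ read as $\Psi_2(x)=x$); (ii) if $m=2$, $\Psi_n(x)\equiv x^{\varphi(p^k)}$; (iii) if $m\geq3$ and $p>2$, then $\Psi_n(x)$ factors as a product of $\varphi(m)/\delta$ distinct irreducible monic polynomials of degree $\delta$, each raised to the power $\varphi(p^k)$, where $\delta$ is defined as follows: with $u$ the multiplicative order of $p$ modulo $2m$, $\delta=u/2$ if ($p\equiv1\pmod4$, $u$ even, $p^{u/2}\equiv-1\pmod{2m}$) or ($p\equiv3\pmod4$, $u\equiv0\pmod4$, $p^{u/2}\equiv-1\pmod{2m}$) or ($p\equiv3\pmod4$, $u\equiv2\pmod4$, $p^{u/2}\equiv m\pm1\pmod{2m}$); $\delta=2u$ if $p\equiv3\pmod4$ and $u$ is odd; and $\delta=u$ otherwise; (iv) if $m\geq3$ and $p=2$, then $\Psi_n(x)$ factors as a product of $\varphi(m)/(2\delta)$ distinct irreducible monic polynomials of degree $\delta$, each raised to the power $2\varphi(2^k)$, where, with $u'$ the multiplicative order of $2$ modulo $m$, $\delta=u'/2$ if $u'$ is even and $2^{u'/2}\equiv-1\pmod m$, and $\delta=u'$ otherwise.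
   Context: The Fibonacci polynomials are defined by $F_1(x)=1$, $F_2(x)=x$, and $F_n(x)=xF_{n-1}(x)+F_{n-2}(x)$ for $n\geq 3$. For $n\geq 2$, the $n$-th fibotomic polynomial $\Psi_n(x)\in\mathbb{Z}[x]$ is the product of the monic irreducible factors of $F_n(x)$ which are not factors of $F_k(x)$ for any $k<n$; also $\Psi_1(x)=1$. For $n\ge2$, $\Psi_n$ is monic of degree $\varphi(n)$, where $\varphi$ is Euler's totient function. $\mathbb{Z}_p$ is the field with $p$ elements, and factorization in $\mathbb{Z}_p[x]$ refers to the reduction of $\Psi_n(x)$ modulo $p$. *)

theory Defs
  imports "HOL-Number_Theory.Number_Theory" "HOL-Computational_Algebra.Polynomial"
    "Berlekamp_Zassenhaus.Finite_Field"
begin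

text \<open>Fibonacci polynomials: F_1 = 1, F_2 = x, F_n = x F_(n-1) + F_(n-2).
  (F_0 = 0 is the natural extension and is never used below.)\<close>
fun fib_poly :: "nat \<Rightarrow> int poly" where
  "fib_poly 0 = 0"
| "fib_poly (Suc 0) = 1"
| "fib_poly (Suc (Suc n)) = [:0, 1:] * fib_poly (Suc n) + fib_poly n"

definition fibotomic :: "nat \<Rightarrow> int poly" where
  "fibotomic n = (if n \<le> 1 then 1 else
     \<Prod>{q. lead_coeff q = 1 \<and> irreducible q \<and> q dvd fib_poly n \<and>
           (\<forall>k. 1 \<le> k \<and> k < n \<longrightarrow> \<not> q dvd fib_poly k)})"

definition reduce_mod :: "int poly \<Rightarrow> 'p::prime_card mod_ring poly" where
  "reduce_mod f = map_poly of_int f"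

definition delta_odd :: "nat \<Rightarrow> nat \<Rightarrow> nat" where
  "delta_odd p m = (let u = ord (2 * m) p in
     if ([p = 1] (mod 4) \<and> even u \<and> [p ^ (u div 2) + 1 = 0] (mod 2 * m))
      \<or> ([p = 3] (mod 4) \<and> [u = 0] (mod 4) \<and> [p ^ (u div 2) + 1 = 0] (mod 2 * m))
      \<or> ([p = 3] (mod 4) \<and> [u = 2] (mod 4) \<and>
          ([p ^ (u div 2) = m + 1] (mod 2 * m) \<or> [p ^ (u div 2) = m - 1] (mod 2 * m)))
     then u div 2
     else if [p = 3] (mod 4) \<and> odd u then 2 * u
     else u)"

definition delta_two :: "nat \<Rightarrow> nat" where
  "delta_two m = (let u = ord m 2 in
     if even u \<and> [2 ^ (u div 2) + 1 = 0] (mod m) then u div 2 else u)"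

end

theory Submission
  imports "Berlekamp_Zassenhaus.Distinct_Degree_Factorization" Defs
begin

text \<open>
  Write \<open>L\<^sub>n = 2 F\<^bsub>n+1\<^esub> - x F\<^sub>n\<close> and \<open>D = x\<^sup>2 + 4\<close>. A prime \<open>q\<close> of \<open>R[x]\<close> divides \<open>F\<^sub>n\<close> exactly when its
  rank of apparition divides \<open>n\<close>, and \<open>D F\<^sub>n' = n L\<^sub>n - x F\<^sub>n\<close> controls repeated factors; over the
  integers this gives \<open>F\<^sub>n = \<Prod>\<^bsub>d|n\<^esub> \<Psi>\<^sub>d\<close>. Modulo \<open>p\<close>, Frobenius in \<open>R[t]/(t\<^sup>2 - x t - 1)\<close>, where
  \<open>t\<^bsup>n+1\<^esup> = F\<^bsub>n+1\<^esub> t + F\<^sub>n\<close>, yields \<open>F\<^bsub>sm\<^esub> = F\<^sub>m\<^sup>s F\<^sub>s\<close> and \<open>L\<^sub>s = x\<^sup>s\<close> for \<open>s = p\<^sup>k\<close>, which reduces the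
  problem to \<open>n = m\<close> prime to \<open>p\<close>. There the irreducible factors of \<open>\<Psi>\<^sub>m\<close> are the primes of rank \<open>m\<close>,
  all simple (for \<open>p = 2\<close> all double). Finally \<open>x\<^sup>s - x = L\<^sub>s - L\<^sub>1\<close> factors as \<open>D F\<^sub>a F\<^bsub>a+1\<^esub>\<close> or
  \<open>L\<^sub>a L\<^bsub>a+1\<^esub>\<close> with \<open>s = 2a + 1\<close>
  (for \<open>p = 2\<close>, its square is \<open>x\<^sup>2 F\<^bsub>s-1\<^esub> F\<^bsub>s+1\<^esub>\<close>), so whether \<open>q\<close> divides \<open>x\<^sup>s - x\<close> is a congruence condition on \<open>s\<close>
  alone, and the degree of \<open>q\<close> is the least \<open>d\<close> such that \<open>p\<^sup>d\<close> satisfies it.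
\<close>

(* Unique_Factorization hides Rings.coprime in favour of a notion of its own. *)
hide_const (open) Unique_Factorization.coprime
alias coprime = Rings.coprime

section \<open>Fibonacci and Lucas sequences in a commutative ring\<close>

text \<open>The argument is any ring element, so the same identities serve integer polynomials and
  polynomials modulo \<open>p\<close>, both taken at \<open>[:0, 1:]\<close>.\<close>

fun fibo :: "'a::comm_ring_1 \<Rightarrow> nat \<Rightarrow> 'a" where
  "fibo x 0 = 0"
| "fibo x (Suc 0) = 1"
| "fibo x (Suc (Suc n)) = x * fibo x (Suc n) + fibo x n"

text \<open>This is the Lucas sequence \<open>F_(n+1) + F_(n-1)\<close>, starting with 2 and
  \<open>x\<close>, in a form that needs no predecessor of \<open>n\<close>.\<close>

definition luc :: "'a::comm_ring_1 \<Rightarrow> nat \<Rightarrow> 'a" where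
  "luc x n = 2 * fibo x (Suc n) - x * fibo x n"

lemma fib_poly_eq_fibo: "fib_poly n = fibo [:0, 1:] n"
  by (induction n rule: fib_poly.induct) auto

lemma fibo_add: "fibo x (m + Suc n) = fibo x (Suc m) * fibo x (Suc n) + fibo x m * fibo x n"
\<comment> \<open>The rule of \<open>fib_poly\<close> serves only as two-step induction with base
  cases 0 and 1.\<close>
proof (induction m rule: fib_poly.induct)
  case (3 m)
  have "fibo x (Suc (Suc m) + Suc n) = x * fibo x (Suc m + Suc n) + fibo x (m + Suc n)"
    by simp
  also have "\<dots> = fibo x (Suc (Suc (Suc m))) * fibo x (Suc n) + fibo x (Suc (Suc m)) * fibo x n"
    unfolding 3 by (simp add: algebra_simps)
  finally show ?case .
qed auto

lemma fibo_odd: "fibo x (Suc (2 * n)) = fibo x (Suc n) ^ 2 + fibo x n ^ 2"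
  using fibo_add[of x n n] by (simp add: power2_eq_square mult_2)

section \<open>Doubling, Cassini's identity and product formulas\<close>

lemma fibo_even: "fibo x (2 * n) = fibo x n * luc x n"
proof (cases n)
  case (Suc k)
  have "fibo x (2 * n) = fibo x (Suc k + Suc k)" using Suc by (simp add: mult_2)
  also have "\<dots> = fibo x n * luc x n"
    unfolding fibo_add luc_def Suc by (simp add: algebra_simps)
  finally show ?thesis .
qed (auto simp: luc_def)

text \<open>Up to sign the left side is the norm of \<open>t^(n+1) = F_(n+1) t + F_n\<close>, and
  \<open>t\<close> has norm -1. Accordingly one step of the recurrence flips the sign.\<close>

lemma fibo_cassini:
  "fibo x (Suc n) ^ 2 - x * fibo x n * fibo x (Suc n) - fibo x n ^ 2 = (-1) ^ n"
proof (induction n)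
  case (Suc n)
  have "fibo x (Suc (Suc n)) ^ 2 - x * fibo x (Suc n) * fibo x (Suc (Suc n)) - fibo x (Suc n) ^ 2
     = - (fibo x (Suc n) ^ 2 - x * fibo x n * fibo x (Suc n) - fibo x n ^ 2)"
    by (simp add: algebra_simps power2_eq_square)
  then show ?case using Suc by simp
qed auto

text \<open>For \<open>n\<close> even and \<open>s = 2 n + 1\<close> a power of an odd
  characteristic, the left side becomes \<open>x^s\<close>, and this factors
  \<open>x^s - x\<close>.\<close>

lemma luc_odd_fibo:
  "luc x (Suc (2 * n)) = (x ^ 2 + 4) * fibo x n * fibo x (Suc n) + (-1) ^ n * x"
proof -
  have eq: "Suc (Suc (2 * n)) = Suc n + Suc n" by simp
  have "fibo x (Suc (Suc (2 * n))) = x * fibo x (Suc n) ^ 2 + 2 * fibo x n * fibo x (Suc n)"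
    unfolding eq fibo_add by (simp add: power2_eq_square algebra_simps)
  then show ?thesis
    \<comment> \<open>Cassini's identity turns the sign into a quadratic form in two consecutive
      values, so that a plain polynomial identity remains.\<close>
    unfolding luc_def fibo_odd fibo_cassini[symmetric, of n x]
    by (simp add: algebra_simps power2_eq_square)
qed

text \<open>The companion of \<open>luc_odd_fibo\<close> for \<open>n\<close> odd: the opposite sign
  of \<open>x\<close> again isolates \<open>x^s - x\<close>.\<close>

lemma luc_odd_luc:
  "luc x (Suc (2 * n)) = luc x n * luc x (Suc n) - (-1) ^ n * x"
  unfolding luc_odd_fibo
  unfolding luc_def fibo_cassini[symmetric, of n x]
  by (simp add: algebra_simps power2_eq_square)

text \<open>Meant for characteristic two, where the index is a power of 2 and
  \<open>x ^ 2 + 2\<close> collapses to \<open>x ^ 2\<close>.\<close>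

lemma luc_even:
  "luc x (2 * Suc n) = (x ^ 2 + 4) * fibo x n * fibo x (Suc (Suc n)) + (-1) ^ n * (x ^ 2 + 2)"
proof -
  have eq: "2 * Suc n = Suc n + Suc n" by simp
  have "fibo x (2 * Suc n) = x * fibo x (Suc n) ^ 2 + 2 * fibo x n * fibo x (Suc n)"
    unfolding eq fibo_add by (simp add: power2_eq_square algebra_simps)
  then show ?thesis
    unfolding luc_def fibo_odd fibo_cassini[symmetric, of n x]
    by (simp add: algebra_simps power2_eq_square)
qed

text \<open>Running the recurrence backwards carries the common divisor down to
  \<open>F_1 = 1\<close>.\<close>

lemma fibo_consecutive:
  "q dvd fibo x n \<Longrightarrow> q dvd fibo x (Suc n) \<Longrightarrow> q dvd 1"
proof (induction n)
  case (Suc n)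
  have "q dvd fibo x (Suc (Suc n)) - x * fibo x (Suc n)"
    using Suc.prems by (intro dvd_diff dvd_mult)
  then show ?case using Suc by simp
qed auto

section \<open>Derivative, degree and leading coefficient\<close>

text \<open>This relation replaces a discriminant: a repeated factor of \<open>F_n\<close> divides
  the left side and hence \<open>n L_n\<close>.\<close>

lemma pderiv_fibo:
  fixes n :: nat and X :: "'a::idom poly"
  defines "X \<equiv> [:0, 1:]"
  shows "(X ^ 2 + 4) * pderiv (fibo X n) = of_nat n * luc X n - X * fibo X n"
proof (induction n rule: fib_poly.induct)
  case 2
  then show ?case by (simp add: luc_def X_def pderiv_1)
next
  case (3 n)
  have X: "pderiv X = 1" by (simp add: X_def pderiv_pCons)
  have "(X ^ 2 + 4) * pderiv (fibo X (Suc (Suc n)))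
    = (X ^ 2 + 4) * fibo X (Suc n) + X * ((X ^ 2 + 4) * pderiv (fibo X (Suc n)))
       + (X ^ 2 + 4) * pderiv (fibo X n)"
    by (simp add: pderiv_add pderiv_mult X algebra_simps)
  also have "\<dots> = of_nat (Suc (Suc n)) * luc X (Suc (Suc n)) - X * fibo X (Suc (Suc n))"
    unfolding 3 luc_def by (simp add: algebra_simps power2_eq_square)
  finally show ?case .
qed (auto simp: X_def)

lemma fibo_poly_monic_degree:
  "lead_coeff (fibo [:0, 1 :: 'a::idom:] (Suc n)) = 1 \<and> degree (fibo [:0, 1 :: 'a:] (Suc n)) = n"
proof (induction n rule: fib_poly.induct)
  case (3 n)
  let ?F = "fibo [:0, 1 :: 'a:]"
  have nz: "?F (Suc (Suc n)) \<noteq> 0" using 3 by auto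
  have d: "degree ([:0, 1:] * ?F (Suc (Suc n))) = Suc (Suc n)"
    using nz 3 by (subst degree_mult_eq) auto
  have lt: "degree (?F (Suc n)) < degree ([:0, 1:] * ?F (Suc (Suc n)))" using 3 d by simp
  have l: "lead_coeff ([:0, 1:] * ?F (Suc (Suc n))) = 1"
    using 3 by (subst lead_coeff_mult) auto
  have "degree ([:0, 1:] * ?F (Suc (Suc n)) + ?F (Suc n)) = Suc (Suc n)"
    using degree_add_eq_left[OF lt] d by (simp only:)
  moreover have "lead_coeff ([:0, 1:] * ?F (Suc (Suc n)) + ?F (Suc n)) = 1"
    using lead_coeff_add_le[OF lt] l by (simp only: add.commute)
  ultimately show ?case
    unfolding fibo.simps(3)[of _ "Suc n"] by blast
qed auto

section \<open>Rank of apparition\<close>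

text \<open>Modulo \<open>q\<close>, raising the index by \<open>r\<close> multiplies the value by
  \<open>F_(r-1)\<close>. This is nonzero modulo \<open>q\<close> because its neighbour
  \<open>F_r\<close> vanishes, so \<open>n\<close> may be reduced modulo \<open>r\<close>.\<close>

lemma prime_elem_dvd_fibo_iff:
  assumes q: "prime_elem q" and r: "r > 0" "q dvd fibo x r"
    and least: "\<And>k. 0 < k \<Longrightarrow> k < r \<Longrightarrow> \<not> q dvd fibo x k"
  shows "q dvd fibo x n \<longleftrightarrow> r dvd n"
proof (induction n rule: less_induct)
  case (less n)
  show ?case
  proof (cases "n < r")
    case True
    then show ?thesis using least[of n] by (cases "n = 0") (auto dest: dvd_imp_le)
  next
    case False
    obtain s where s: "r = Suc s" using r(1) by (cases r) auto
    have eq: "fibo x n = fibo x (Suc (n - r)) * fibo x r + fibo x (n - r) * fibo x s"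
      using fibo_add[of x "n - r" s] False s by simp
    have "\<not> q dvd fibo x s"
      using fibo_consecutive[of q x s] r(2) q unfolding s prime_elem_def by auto
    then have "q dvd fibo x n \<longleftrightarrow> q dvd fibo x (n - r)"
      unfolding eq using r(2) q by (simp add: dvd_add_right_iff prime_elem_dvd_mult_iff)
    also have "\<dots> \<longleftrightarrow> r dvd n - r" using less[of "n - r"] r(1) False by auto
    also have "\<dots> \<longleftrightarrow> r dvd n" using False by (simp add: dvd_minus_self)
    finally show ?thesis .
  qed
qed

lemma fibo_rank_exists:
  assumes q: "prime_elem q" and n: "n > 0" "q dvd fibo x n"
  obtains r where "r > 0" "r dvd n" "q dvd fibo x r" "\<And>k. 0 < k \<Longrightarrow> k < r \<Longrightarrow> \<not> q dvd fibo x k"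
proof -
  define r where "r = (LEAST r. r > 0 \<and> q dvd fibo x r)"
  have r: "r > 0 \<and> q dvd fibo x r" unfolding r_def by (rule LeastI[of _ n]) (use n in auto)
  have l: "\<not> q dvd fibo x k" if "0 < k" "k < r" for k
    using not_less_Least[of k "\<lambda>r. r > 0 \<and> q dvd fibo x r"] that unfolding r_def by auto
  have "r dvd n" using prime_elem_dvd_fibo_iff[OF q, of r x n] r l n by auto
  then show ?thesis using that r l by auto
qed

section \<open>Fibotomic polynomials over the integers\<close>

text \<open>Either alternative puts \<open>q\<close> into \<open>(x^2 + 4)\<close> times the
  derivative of \<open>F_n\<close>. Through \<open>pderiv_fibo\<close> it then divides
  \<open>2 n F_(n+1)\<close>, but not \<open>F_(n+1)\<close>.\<close>

lemma dvd_fibo_imp_dvd_of_nat: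
  fixes q :: "'a::idom poly"
  assumes q: "prime_elem q" and F: "q dvd fibo [:0, 1:] n"
    and D: "q dvd [:0, 1:] ^ 2 + 4 \<or> q ^ 2 dvd fibo [:0, 1:] n"
  shows "q dvd of_nat (2 * n)"
proof -
  let ?X = "[:0, 1 :: 'a:]"
  have "q dvd pderiv (fibo ?X n)" if sq: "q ^ 2 dvd fibo ?X n"
  proof -
    obtain h where h: "fibo ?X n = q ^ 2 * h" using sq unfolding dvd_def by blast
    show ?thesis unfolding h by (simp add: pderiv_mult power2_eq_square)
  qed
  then have "q dvd (?X ^ 2 + 4) * pderiv (fibo ?X n)"
    using D dvd_mult dvd_mult2 by blast
  \<comment> \<open>The multiple of \<open>F_n\<close> is chosen to cancel all terms in
    \<open>x F_n\<close>, leaving \<open>2 n F_(n+1)\<close>.\<close>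
  then have "q dvd (?X ^ 2 + 4) * pderiv (fibo ?X n) + (of_nat n + 1) * ?X * fibo ?X n"
    using F by (intro dvd_add[OF _ dvd_mult])
  also have "(?X ^ 2 + 4) * pderiv (fibo ?X n) + (of_nat n + 1) * ?X * fibo ?X n
     = of_nat (2 * n) * fibo ?X (Suc n)"
    unfolding pderiv_fibo luc_def by (simp add: algebra_simps)
  finally have "q dvd of_nat (2 * n) * fibo ?X (Suc n)" .
  moreover have "\<not> q dvd fibo ?X (Suc n)"
    using fibo_consecutive[OF F] q unfolding prime_elem_def by auto
  ultimately show ?thesis using q by (simp only: prime_elem_dvd_mult_iff) blast
qed

text \<open>Library prime factors are normalized, and a factor of a monic polynomial has a unit
  leading coefficient, which normalization makes 1. This ties the set in \<open>fibotomic\<close> to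
  unique factorization.\<close>

lemma prime_factors_monic:
  fixes f :: "'a::{factorial_ring_gcd, semiring_gcd_mult_normalize} poly"
  assumes f: "lead_coeff f = 1"
  shows "prime_factors f = {q. lead_coeff q = 1 \<and> irreducible q \<and> q dvd f}"
proof (intro equalityI subsetI)
  fix q assume "q \<in> prime_factors f"
  then have q: "prime q" "q dvd f" by (auto simp: in_prime_factors_iff)
  have nz: "q \<noteq> 0" using q(1) by auto
  have "lead_coeff q dvd lead_coeff f"
    using q(2) by (auto elim!: dvdE simp: lead_coeff_mult)
  then have u: "is_unit (lead_coeff q)" using f by simp
  have "unit_factor q = 1"
    using normalize_prime[OF q(1)] nz by (metis unit_factor_normalize)
  then have "[:unit_factor (lead_coeff q):] = 1" by (simp add: unit_factor_poly_def)
  then have "unit_factor (lead_coeff q) = 1" by (metis one_pCons pCons_eq_iff)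
  then have "lead_coeff q = 1" using is_unit_unit_factor[OF u] by simp
  then show "q \<in> {q. lead_coeff q = 1 \<and> irreducible q \<and> q dvd f}"
    using q by (auto intro: prime_elem_imp_irreducible)
next
  fix q assume "q \<in> {q. lead_coeff q = 1 \<and> irreducible q \<and> q dvd f}"
  then show "q \<in> prime_factors f"
    using f by (auto simp: in_prime_factors_iff normalization_semidom_class.prime_def irreducible_imp_prime_elem normalize_monic)
qed

lemma monic_squarefree_eq_prod:
  fixes f :: "'a::{factorial_ring_gcd, semiring_gcd_mult_normalize} poly"
  assumes f: "lead_coeff f = 1"
    and sq: "\<And>q. lead_coeff q = 1 \<Longrightarrow> irreducible q \<Longrightarrow> \<not> q ^ 2 dvd f"
  shows "finite {q. lead_coeff q = 1 \<and> irreducible q \<and> q dvd f}"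
    and "f = \<Prod>{q. lead_coeff q = 1 \<and> irreducible q \<and> q dvd f}"
proof -
  have nz: "f \<noteq> 0" using f by auto
  show "finite {q. lead_coeff q = 1 \<and> irreducible q \<and> q dvd f}"
    using prime_factors_monic[OF f] by (metis finite_set_mset)
  have mult: "multiplicity q f = 1" if "q \<in> prime_factors f" for q
  proof -
    have q: "lead_coeff q = 1" "irreducible q" "q dvd f"
      using that unfolding prime_factors_monic[OF f] by auto
    have nu: "\<not> is_unit q" using q(2) by (simp add: irreducible_def)
    have "multiplicity q f > 0" using q nz nu by (simp add: multiplicity_gt_zero_iff)
    moreover have "\<not> multiplicity q f \<ge> 2"
      using sq[OF q(1,2)] multiplicity_dvd'[of 2 q f] by auto
    ultimately show ?thesis by simp
  qed
  have "prod_mset (prime_factorization f)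
      = (\<Prod>q\<in>prime_factors f. q ^ count (prime_factorization f) q)"
    by (rule prod_mset_multiplicity)
  also have "\<dots> = \<Prod>(prime_factors f)"
    by (intro prod.cong)
      (auto simp: mult count_prime_factorization_prime in_prime_factors_iff)
  finally have eq: "prod_mset (prime_factorization f) = \<Prod>(prime_factors f)" .
  have "monic (\<Prod>(prime_factors f))"
    by (rule monic_prod) (auto simp: prime_factors_monic[OF f])
  then have "f = \<Prod>(prime_factors f)"
    using prod_mset_prime_factorization_weak[OF nz] f unfolding eq by (metis normalize_monic)
  then show "f = \<Prod>{q. lead_coeff q = 1 \<and> irreducible q \<and> q dvd f}"
    unfolding prime_factors_monic[OF f] .
qed

text \<open>A repeated factor would divide the nonzero constant \<open>2 n\<close>, so it would be
  constant and, being monic, equal to 1.\<close>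

lemma fib_poly_squarefree:
  assumes n: "n > 0" and q: "lead_coeff q = 1" "irreducible q"
  shows "\<not> q ^ 2 dvd fib_poly n"
proof
  assume "q ^ 2 dvd fib_poly n"
  then have d: "q dvd of_nat (2 * n)"
    using dvd_fibo_imp_dvd_of_nat[of q n] q irreducible_imp_prime_elem[of q]
      dvd_trans[of q "q ^ 2" "fib_poly n"]
    by (simp add: fib_poly_eq_fibo)
  have c: "(of_nat (2 * n) :: int poly) = [:of_nat (2 * n):]" by (simp add: of_nat_poly)
  have "degree q = 0"
    using divides_degree[OF d] n unfolding c by auto
  then obtain a where "q = [:a:]" by (auto elim: degree_eq_zeroE)
  then have "q = 1" using q(1) by (simp add: pCons_one)
  then show False using q(2) by simp
qed

lemma fib_poly_monic: "n > 0 \<Longrightarrow> lead_coeff (fib_poly n) = 1"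
  using fibo_poly_monic_degree[where 'a = int, of "n - 1"] fib_poly_eq_fibo[of n]
  by (metis Suc_pred')

text \<open>The index 1 fits the general formula because \<open>F_1 = 1\<close> has no irreducible
  factor.\<close>

lemma fibotomic_eq_prod:
  assumes "n > 0"
  shows "fibotomic n = \<Prod>{q. lead_coeff q = 1 \<and> irreducible q \<and> q dvd fib_poly n \<and>
           (\<forall>k. 1 \<le> k \<and> k < n \<longrightarrow> \<not> q dvd fib_poly k)}"
proof (cases "n = 1")
  case True
  have "\<not> q dvd 1" if "irreducible q" for q :: "int poly"
    using that by (auto simp: irreducible_def)
  then have "{q. lead_coeff q = 1 \<and> irreducible q \<and> q dvd fib_poly n \<and>
           (\<forall>k. 1 \<le> k \<and> k < n \<longrightarrow> \<not> q dvd fib_poly k)} = {}"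
    using True by auto
  then show ?thesis by (metis True fibotomic_def order_refl prod.empty)
qed (use assms in \<open>simp add: fibotomic_def\<close>)

text \<open>The irreducible factors of the squarefree \<open>F_n\<close> are sorted by rank: each
  rank divides \<open>n\<close>, and the factors of rank \<open>d\<close> make up
  \<open>fibotomic d\<close>.\<close>

lemma prod_fibotomic:
  assumes n: "n > 0"
  shows "(\<Prod>d | d dvd n. fibotomic d) = fib_poly n"
proof -
  define S where "S = (\<lambda>n. {q. lead_coeff q = 1 \<and> irreducible q \<and> q dvd fib_poly n})"
  define P where "P = (\<lambda>n. {q. lead_coeff q = 1 \<and> irreducible q \<and> q dvd fib_poly n \<and>
           (\<forall>k. 1 \<le> k \<and> k < n \<longrightarrow> \<not> q dvd fib_poly k)})"
  have pe: "prime_elem q" if "irreducible q" for q :: "int poly"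
    using that by (rule irreducible_imp_prime_elem)
  have fin: "finite (S k)" if "k > 0" for k
    unfolding S_def
    by (rule monic_squarefree_eq_prod) (use that fib_poly_monic fib_poly_squarefree in auto)
  have sub: "P k \<subseteq> S k" for k by (auto simp: P_def S_def)
  have S_eq: "S n = (\<Union>d\<in>{d. d dvd n}. P d)"
  proof (intro equalityI subsetI)
    fix q assume "q \<in> S n"
    then have q: "lead_coeff q = 1" "irreducible q" "q dvd fib_poly n" by (auto simp: S_def)
    obtain r where r: "r > 0" "r dvd n" "q dvd fib_poly r"
      "\<And>k. 0 < k \<Longrightarrow> k < r \<Longrightarrow> \<not> q dvd fib_poly k"
      using fibo_rank_exists[OF pe[OF q(2)] n] q(3) unfolding fib_poly_eq_fibo by metis
    then show "q \<in> (\<Union>d\<in>{d. d dvd n}. P d)" using q by (auto simp: P_def)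
  next
    fix q assume "q \<in> (\<Union>d\<in>{d. d dvd n}. P d)"
    then obtain d where d: "d dvd n" "q \<in> P d" by auto
    have "d > 0" using d n by (auto intro: Nat.gr0I)
    then have "q dvd fib_poly n"
      using prime_elem_dvd_fibo_iff[of q d "[:0, 1:]" n] d pe[of q]
      unfolding P_def fib_poly_eq_fibo by auto
    then show "q \<in> S n" using d by (auto simp: S_def P_def)
  qed
  have disj: "P d \<inter> P e = {}" if "d \<noteq> e" "d > 0" "e > 0" for d e
    using that by (cases d e rule: linorder_cases) (force simp: P_def)+
  have pos: "d > 0" if "d dvd n" for d using that n by (auto intro: Nat.gr0I)
  have "fib_poly n = \<Prod>(S n)"
    unfolding S_def
    by (rule monic_squarefree_eq_prod) (use n fib_poly_monic fib_poly_squarefree in auto)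
  also have "\<dots> = (\<Prod>d | d dvd n. \<Prod>(P d))"
    unfolding S_eq
    by (rule prod.UNION_disjoint)
      (use n disj pos finite_subset[OF sub fin] in \<open>auto simp: finite_divisors_nat\<close>)
  also have "\<dots> = (\<Prod>d | d dvd n. fibotomic d)"
    by (intro prod.cong) (use pos in \<open>auto simp: fibotomic_eq_prod P_def\<close>)
  finally show ?thesis by simp
qed

lemma fibotomic_monic: "lead_coeff (fibotomic n) = 1"
proof (cases "n = 0")
  case False
  then show ?thesis
    unfolding fibotomic_eq_prod[OF neq0_conv[THEN iffD1, OF False]] by (intro monic_prod) auto
qed (simp add: fibotomic_def)

text \<open>Taking degrees in \<open>prod_fibotomic\<close> yields the recursion of
  \<open>totient\<close>. The divisor 1 adds 0 to the degrees but 1 to the totients, which matches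
  \<open>F_n\<close> having degree \<open>n - 1\<close>.\<close>

lemma degree_fibotomic: "n \<ge> 2 \<Longrightarrow> degree (fibotomic n) = totient n"
proof (induction n rule: less_induct)
  case (less n)
  let ?D = "{d. d dvd n} - {1, n}"
  have fin: "finite {d. d dvd n}" using less.prems by (auto simp: finite_divisors_nat)
  have split: "{d. d dvd n} = insert 1 (insert n ?D)" by auto
  have "(\<Sum>d | d dvd n. degree (fibotomic d)) = degree (\<Prod>d | d dvd n. fibotomic d)"
    by (rule degree_prod_eq_sum_degree[symmetric]) (metis fibotomic_monic leading_coeff_0_iff zero_neq_one)
  also have "\<dots> = n - 1"
    using less.prems fibo_poly_monic_degree[where 'a = int, of "n - 1"]
    by (simp add: prod_fibotomic fib_poly_eq_fibo)
  also have "(\<Sum>d | d dvd n. degree (fibotomic d))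
     = degree (fibotomic n) + (\<Sum>d\<in>?D. degree (fibotomic d))"
    using less.prems fin by (subst split) (simp add: fibotomic_def)
  also have "(\<Sum>d\<in>?D. degree (fibotomic d)) = (\<Sum>d\<in>?D. totient d)"
  proof (intro sum.cong refl less)
    fix d assume d: "d \<in> ?D"
    then show "d < n" using less.prems dvd_imp_le[of d n] by auto
    show "d \<ge> 2" using d less.prems by (cases "d = 0") auto
  qed
  finally have "degree (fibotomic n) + (\<Sum>d\<in>?D. totient d) = n - 1" .
  moreover have "1 + (totient n + (\<Sum>d\<in>?D. totient d)) = n"
    using totient_divisor_sum[of n] less.prems fin by (subst (asm) split) simp
  ultimately show ?case by simp
qed

section \<open>Frobenius\<close>

text \<open>Congruence modulo this quadratic stands for equality in the quotient ring of
  \<open>t\<close>.\<close>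

lemma quadratic_dvd_power_minus_fibo:
  "[:-1, -x, 1:] dvd [:0, 1:] ^ Suc n - [:fibo x n, fibo x (Suc n):]"
proof (induction n)
  case (Suc n)
  have "[:0, 1:] ^ Suc (Suc n) - [:fibo x (Suc n), fibo x (Suc (Suc n)):]
    = [:0, 1:] * ([:0, 1:] ^ Suc n - [:fibo x n, fibo x (Suc n):])
      + [:fibo x (Suc n):] * [:-1, -x, 1:]"
    by (simp add: algebra_simps)
  also have "[:-1, -x, 1:] dvd \<dots>"
    by (rule dvd_add[OF dvd_mult[OF Suc] dvd_triv_right])
  finally show ?case .
qed auto

lemma quadratic_dvd_linear:
  fixes x :: "'a::idom"
  assumes "[:-1, -x, 1:] dvd [:a, b:]"
  shows "a = 0" "b = 0"
proof -
  have "[:a, b:] = 0"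
  proof (rule ccontr)
    assume "[:a, b:] \<noteq> 0"
    then have "degree [:-1, -x, 1:] \<le> degree [:a, b:]"
      using assms dvd_imp_degree_le by blast
    moreover have "degree [:a, b:] \<le> 1" using degree_pCons_le[of a "[:b:]"] by simp
    ultimately show False by simp
  qed
  then show "a = 0" "b = 0" by auto
qed

lemma dvd_power_diff:
  fixes a b m :: "'a::comm_ring_1"
  assumes "m dvd a - b"
  shows "m dvd a ^ n - b ^ n"
  using assms power_diff_sumr2[of a n b] by simp

text \<open>\<open>T^(s n)\<close> is evaluated twice modulo the quadratic: directly, and as the
  \<open>s\<close>-th power of \<open>T^n\<close> by Frobenius, with \<open>T^s\<close> expanded
  afterwards. The coefficients of \<open>T\<close> must agree.\<close>

lemma fibo_char_power_mult:
  fixes x :: "'a::idom"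
  assumes p: "prime CHAR('a)" and s: "s = CHAR('a) ^ k" and n: "n > 0"
  shows "fibo x (s * n) = fibo x n ^ s * fibo x s"
proof -
  let ?M = "[:-1, -x, 1:]" and ?T = "[:0, 1 :: 'a:]"
  have s0: "s > 0" using p s by (simp add: prime_gt_0_nat)
  obtain n' where n': "n = Suc n'" using n by (cases n) auto
  obtain s' where s': "s = Suc s'" using s0 by (cases s) auto
  obtain r where r: "s * n = Suc r" using s0 n by (cases "s * n") auto
  have p': "prime CHAR('a poly)" using p by simp
  have s2: "s = CHAR('a poly) ^ k" using s by simp
  have 1: "?M dvd ?T ^ (s * n) - [:fibo x r, fibo x (s * n):]"
    unfolding r by (rule quadratic_dvd_power_minus_fibo)
  have "?M dvd (?T ^ n) ^ s - [:fibo x n', fibo x n:] ^ s"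
    unfolding n' by (rule dvd_power_diff[OF quadratic_dvd_power_minus_fibo])
  also have "[:fibo x n', fibo x n:] ^ s = ([:fibo x n':] + [:fibo x n:] * ?T) ^ s" by simp
  also have "\<dots> = [:fibo x n':] ^ s + ([:fibo x n:] * ?T) ^ s"
    by (rule freshmans_dream'[OF p' s2])
  also have "\<dots> = [:fibo x n' ^ s:] + [:fibo x n ^ s:] * ?T ^ s"
    by (simp only: power_mult_distrib poly_const_pow)
  finally have 2: "?M dvd ?T ^ (s * n) - ([:fibo x n' ^ s:] + [:fibo x n ^ s:] * ?T ^ s)"
    by (simp only: power_mult[symmetric] mult.commute)
  have 3: "?M dvd [:fibo x n ^ s:] * (?T ^ s - [:fibo x s', fibo x s:])"
    unfolding s' by (rule dvd_mult[OF quadratic_dvd_power_minus_fibo])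
  \<comment> \<open>This combination eliminates all powers of \<open>T\<close>; a linear polynomial
    divisible by a monic quadratic is zero.\<close>
  have "?M dvd (?T ^ (s * n) - ([:fibo x n' ^ s:] + [:fibo x n ^ s:] * ?T ^ s))
      - (?T ^ (s * n) - [:fibo x r, fibo x (s * n):])
      + [:fibo x n ^ s:] * (?T ^ s - [:fibo x s', fibo x s:])"
    by (rule dvd_add[OF dvd_diff[OF 2 1] 3])
  also have "\<dots> = [:fibo x r - fibo x n' ^ s - fibo x n ^ s * fibo x s',
      fibo x (s * n) - fibo x n ^ s * fibo x s:]"
    by (simp add: algebra_simps)
  finally show ?thesis using quadratic_dvd_linear(2) by fastforce
qed

text \<open>\<open>2 T - x\<close> is a square root of \<open>x^2 + 4\<close> modulo the quadratic.
  Its \<open>s\<close>-th power is computed once from this and once by Frobenius; the two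
  coefficients give the two claims.\<close>

lemma fibo_luc_char_power_odd:
  fixes x :: "'a::idom"
  assumes p: "prime CHAR('a)" and s: "s = CHAR('a) ^ k" and odd: "odd CHAR('a)"
  shows "fibo x s = (x ^ 2 + 4) ^ (s div 2)" and "luc x s = x ^ s"
proof -
  let ?M = "[:-1, -x, 1:]" and ?T = "[:0, 1 :: 'a:]" and ?N = "[:-x, 2:]"
  have odds: "odd s" using s odd by simp
  then obtain s' where s': "s = Suc s'" by (cases s) auto
  have p': "prime CHAR('a poly)" using p by simp
  have s2: "s = CHAR('a poly) ^ k" using s by simp
  \<comment> \<open>Frobenius applied to \<open>1 + 1\<close>.\<close>
  have two: "(2 :: 'a) ^ s = 2"
    using freshmans_dream'[OF p s, of 1 1] by simp
  have two0: "(2 :: 'a) \<noteq> 0"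
  proof
    assume "(2 :: 'a) = 0"
    then have "of_nat 2 = (0 :: 'a)" by simp
    then have "CHAR('a) dvd 2" by (simp only: of_nat_eq_0_iff_char_dvd)
    then show False using p odd by (metis primes_dvd_imp_eq two_is_prime_nat even_numeral)
  qed
  let ?E = "(x ^ 2 + 4) ^ (s div 2)"
  have "?N ^ 2 - [:x ^ 2 + 4:] = 4 * ?M"
    by (simp add: power2_eq_square numeral_poly)
  then have "?M dvd ?N ^ 2 - [:x ^ 2 + 4:]" by (metis dvd_triv_right)
  then have "?M dvd (?N ^ 2) ^ (s div 2) - [:x ^ 2 + 4:] ^ (s div 2)" by (rule dvd_power_diff)
  then have "?M dvd ?N * ((?N ^ 2) ^ (s div 2) - [:x ^ 2 + 4:] ^ (s div 2))" by (rule dvd_mult)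
  also have "\<dots> = ?N * (?N ^ 2) ^ (s div 2) - ?N * [:?E:]"
    by (simp only: right_diff_distrib poly_const_pow)
  also have "?N * (?N ^ 2) ^ (s div 2) = ?N ^ s"
    using odds by (metis power_mult power_Suc odd_two_times_div_two_succ Suc_eq_plus1)
  also have "?N ^ s = ([:-x:] + [:2:] * ?T) ^ s" by simp
  also have "\<dots> = [:-x:] ^ s + ([:2:] * ?T) ^ s"
    by (rule freshmans_dream'[OF p' s2])
  also have "\<dots> = [:- (x ^ s):] + [:2:] * ?T ^ s"
    using odds by (simp only: power_mult_distrib poly_const_pow two) simp
  finally have 1: "?M dvd [:- (x ^ s):] + [:2:] * ?T ^ s - ?N * [:?E:]" .
  have 2: "?M dvd [:2:] * (?T ^ s - [:fibo x s', fibo x s:])"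
    unfolding s' by (rule dvd_mult[OF quadratic_dvd_power_minus_fibo])
  have "?M dvd [:- (x ^ s):] + [:2:] * ?T ^ s - ?N * [:?E:]
      - [:2:] * (?T ^ s - [:fibo x s', fibo x s:])"
    by (rule dvd_diff[OF 1 2])
  also have "\<dots> = [:- (x ^ s) + x * ?E + 2 * fibo x s', 2 * fibo x s - 2 * ?E:]"
    by (simp add: algebra_simps)
  finally have d: "?M dvd [:- (x ^ s) + x * ?E + 2 * fibo x s', 2 * fibo x s - 2 * ?E:]" .
  show F: "fibo x s = ?E" using quadratic_dvd_linear(2)[OF d] two0 by simp
  have "x ^ s = x * fibo x s + 2 * fibo x s'"
    using quadratic_dvd_linear(1)[OF d] F by (simp add: algebra_simps)
  also have "\<dots> = luc x s" unfolding luc_def s' by (simp add: algebra_simps)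
  finally show "luc x s = x ^ s" ..
qed

lemma char_two_facts:
  assumes "CHAR('a::idom) = 2"
  shows "(2 :: 'a) = 0" "- y = (y :: 'a)" "(y ^ 2 = z ^ 2) = (y = (z :: 'a))"
proof -
  have "of_nat 2 = (0 :: 'a)" using assms by (metis of_nat_CHAR)
  then show two0: "(2 :: 'a) = 0" by simp
  show neg: "- y = y" for y :: 'a
    using two0 by (metis add_eq_0_iff mult_2 mult_zero_left)
  show "(y ^ 2 = z ^ 2) = (y = (z :: 'a))"
    unfolding power2_eq_iff neg by simp
qed

text \<open>Since \<open>2 T - x\<close> loses \<open>T\<close> when \<open>2 = 0\<close>, the value
  at \<open>2^k\<close> is obtained by repeated doubling instead.\<close>

lemma fibo_luc_char_power_two:
  fixes x :: "'a::idom"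
  assumes p: "CHAR('a) = 2"
  shows "fibo x (2 ^ k) = x ^ (2 ^ k - 1)" and "luc x n = x * fibo x n"
    and "luc x (2 ^ k) = x ^ (2 ^ k)"
proof -
  show F: "fibo x (2 ^ k) = x ^ (2 ^ k - 1)"
  proof (induction k)
    case (Suc k)
    have "fibo x (2 * 2 ^ k) = fibo x (2 ^ k) ^ 2 * fibo x 2"
      by (rule fibo_char_power_mult[where k = 1]) (simp_all add: p)
    also have "fibo x 2 = x" by (simp add: numeral_2_eq_2)
    also have "fibo x (2 ^ k) ^ 2 * x = x ^ Suc ((2 ^ k - 1) * 2)"
      unfolding Suc power_mult[symmetric] by simp
    also have "Suc ((2 ^ k - 1) * 2) = 2 ^ Suc k - 1"
      by (cases "2 ^ k :: nat") auto
    finally show ?case by simp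
  qed auto
  show L: "luc x n = x * fibo x n" for n
    unfolding luc_def by (simp add: char_two_facts[OF p])
  show "luc x (2 ^ k) = x ^ (2 ^ k)"
    unfolding L F by (simp flip: power_Suc)
qed

section \<open>Reduction modulo a prime\<close>

text \<open>A substitute for Moebius inversion: strong induction along the divisors, cancelling the
  nonzero product over the proper ones.\<close>

lemma prod_divisors_unique:
  fixes f g :: "nat \<Rightarrow> 'a::idom"
  assumes eq: "\<And>n. n dvd N \<Longrightarrow> (\<Prod>d | d dvd n. f d) = (\<Prod>d | d dvd n. g d)"
    and nz: "\<And>d. d dvd N \<Longrightarrow> g d \<noteq> 0" and N: "N > 0"
  shows "f N = g N"
proof -
  have "n dvd N \<Longrightarrow> f n = g n" for n
  proof (induction n rule: less_induct)
    case (less n)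
    have n: "n > 0" using less.prems N by (auto intro: Nat.gr0I)
    let ?D = "{d. d dvd n} - {n}"
    have fin: "finite {d. d dvd n}" using n by (auto simp: finite_divisors_nat)
    have IH: "f d = g d" if "d \<in> ?D" for d
    proof (rule less.IH)
      show "d < n" using that n dvd_imp_le[of d n] by auto
      show "d dvd N" using that less.prems by (auto intro: dvd_trans)
    qed
    have "f n * (\<Prod>d\<in>?D. f d) = g n * (\<Prod>d\<in>?D. g d)"
      using eq[OF less.prems] prod.remove[OF fin, of n f] prod.remove[OF fin, of n g] by simp
    moreover have "(\<Prod>d\<in>?D. f d) = (\<Prod>d\<in>?D. g d)" by (rule prod.cong) (use IH in auto)
    moreover have "(\<Prod>d\<in>?D. g d) \<noteq> 0"
      using fin nz less.prems by (auto intro: dvd_trans)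
    ultimately show ?case by simp
  qed
  then show ?thesis by simp
qed

lemma totient_prime_power_add:
  assumes "prime p"
  shows "totient (p ^ Suc k) + p ^ k = p ^ Suc k"
  using assms prime_gt_0_nat[OF assms] unfolding totient_prime_power_Suc[OF assms]
  by (cases p) auto

text \<open>Passing from \<open>p^k n\<close> to \<open>p^(k+1) n\<close> adds exactly the divisors
  that contain the full power of \<open>p\<close>. These index the fibotomic factors left in the
  quotient of the two Fibonacci polynomials.\<close>

lemma divisors_prime_power_mult:
  fixes p n :: nat
  assumes p: "prime p" and cop: "coprime p n"
  shows "{d. d dvd p ^ Suc k * n} = {d. d dvd p ^ k * n} \<union> (*) (p ^ Suc k) ` {d. d dvd n}"
    and "{d. d dvd p ^ k * n} \<inter> (*) (p ^ Suc k) ` {d. d dvd n} = {}"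
proof -
  have p0: "p > 0" using p by (rule prime_gt_0_nat)
  have "\<not> p ^ Suc k * d dvd p ^ k * n" for d
  proof
    assume "p ^ Suc k * d dvd p ^ k * n"
    then have "p ^ k * (p * d) dvd p ^ k * n" by (simp add: mult_ac)
    then have "p * d dvd n" using p0 by (simp only: nat_mult_dvd_cancel_disj) auto
    then have "p dvd n" by (rule dvd_mult_left)
    then show False using cop p by (metis coprime_absorb_left not_prime_unit)
  qed
  then show "{d. d dvd p ^ k * n} \<inter> (*) (p ^ Suc k) ` {d. d dvd n} = {}" by auto
  show "{d. d dvd p ^ Suc k * n} = {d. d dvd p ^ k * n} \<union> (*) (p ^ Suc k) ` {d. d dvd n}"
  proof (intro equalityI subsetI)
    fix d assume "d \<in> {d. d dvd p ^ Suc k * n}"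
    then obtain a b where ab: "d = a * b" "a dvd p ^ Suc k" "b dvd n"
      using division_decomp by blast
    obtain j where j: "j \<le> Suc k" "a = p ^ j" 
      using divides_primepow_nat[OF p, THEN iffD1, OF ab(2)] by blast
    show "d \<in> {d. d dvd p ^ k * n} \<union> (*) (p ^ Suc k) ` {d. d dvd n}"
    proof (cases "j = Suc k")
      case False
      then have "a dvd p ^ k" using j by (auto intro: le_imp_power_dvd)
      then have "d dvd p ^ k * n" using ab by (auto intro: mult_dvd_mono)
      then show ?thesis by simp
    qed (use ab j in auto)
  qed (auto simp: mult.assoc)
qed

section \<open>Reduction modulo p as a homomorphism\<close>

lemma reduce_mod_mult: "reduce_mod (f * g) = reduce_mod f * reduce_mod g"
  unfolding reduce_mod_def by (rule of_int_poly_hom.hom_mult)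

lemma reduce_mod_add: "reduce_mod (f + g) = reduce_mod f + reduce_mod g"
  unfolding reduce_mod_def by (rule of_int_poly_hom.hom_add)

lemma reduce_mod_X: "reduce_mod [:0, 1:] = [:0, 1:]"
  unfolding reduce_mod_def by simp

lemma reduce_mod_prod: "reduce_mod (\<Prod>i\<in>A. f i) = (\<Prod>i\<in>A. reduce_mod (f i))"
  unfolding reduce_mod_def by (rule of_int_poly_hom.hom_prod)

lemma reduce_mod_fib_poly: "reduce_mod (fib_poly n) = fibo [:0, 1:] n"
proof (induction n rule: fib_poly.induct)
  case (3 n)
  then show ?case
    by (simp only: fib_poly.simps fibo.simps reduce_mod_mult reduce_mod_add reduce_mod_X)
qed (simp_all add: reduce_mod_def)

lemma reduce_mod_monic:
  assumes "lead_coeff f = 1"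
  shows "lead_coeff (reduce_mod f :: 'p::prime_card mod_ring poly) = 1"
    and "degree (reduce_mod f :: 'p mod_ring poly) = degree f"
proof -
  have "of_int (lead_coeff f) \<noteq> (0 :: 'p mod_ring)" using assms by simp
  then show d: "degree (reduce_mod f :: 'p mod_ring poly) = degree f"
    unfolding reduce_mod_def
    by (intro antisym degree_map_poly_le le_degree) (simp add: coeff_map_poly)
  show "lead_coeff (reduce_mod f :: 'p mod_ring poly) = 1"
    unfolding d unfolding reduce_mod_def by (simp add: coeff_map_poly assms)
qed

lemma prod_reduce_fibotomic:
  "n > 0 \<Longrightarrow> (\<Prod>d | d dvd n. reduce_mod (fibotomic d)) = fibo [:0, 1:] n"
  using prod_fibotomic[of n] by (metis reduce_mod_prod reduce_mod_fib_poly)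

lemma reduce_fibotomic_nonzero: "reduce_mod (fibotomic n) \<noteq> (0 :: 'p::prime_card mod_ring poly)"
  using reduce_mod_monic(1)[OF fibotomic_monic, of n] by (metis leading_coeff_0_iff zero_neq_one)

lemma fibo_poly_nonzero: "n > 0 \<Longrightarrow> fibo [:0, 1 :: 'a::idom:] n \<noteq> 0"
  using fibo_poly_monic_degree[where 'a = 'a, of "n - 1"]
  by (metis Suc_pred' leading_coeff_0_iff zero_neq_one)

section \<open>Indices containing a power of p\<close>

lemma reduce_fibotomic_prime_power:
  "reduce_mod (fibotomic (CARD('p) ^ Suc k)) * fibo [:0, 1:] (CARD('p) ^ k)
     = (fibo [:0, 1:] (CARD('p) ^ Suc k) :: 'p::prime_card mod_ring poly)"
proof -
  let ?p = "CARD('p)"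
  have p: "prime ?p" by (rule prime_card)
  have D: "{d. d dvd ?p ^ Suc k} = insert (?p ^ Suc k) {d. d dvd ?p ^ k}"
    "?p ^ Suc k \<notin> {d. d dvd ?p ^ k}"
    using divisors_prime_power_mult[OF p, of 1 k] by (auto simp del: power_Suc)
  have "(\<Prod>d | d dvd ?p ^ Suc k. reduce_mod (fibotomic d) :: 'p mod_ring poly)
     = reduce_mod (fibotomic (?p ^ Suc k)) * (\<Prod>d | d dvd ?p ^ k. reduce_mod (fibotomic d))"
    unfolding D(1) using D(2) p
    by (subst prod.insert) (auto simp: finite_divisors_nat prime_gt_0_nat)
  then show ?thesis
    using p by (simp only: prod_reduce_fibotomic prime_gt_0_nat zero_less_power)
qed

text \<open>Frobenius compares \<open>F\<close> at two consecutive powers of \<open>p\<close> times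
  \<open>m\<close>, for every \<open>m\<close> dividing \<open>n\<close>; uniqueness of divisor
  products then isolates the factor at \<open>n\<close>.\<close>

lemma reduce_fibotomic_prime_power_mult:
  assumes cop: "coprime CARD('p) n" and n: "n \<ge> 2"
  shows "reduce_mod (fibotomic (CARD('p) ^ k * n))
    = (reduce_mod (fibotomic n) :: 'p::prime_card mod_ring poly) ^ totient (CARD('p) ^ k)"
proof (cases k)
  case (Suc j)
  let ?p = "CARD('p)" and ?X = "[:0, 1 :: 'p mod_ring:]"
  let ?P = "\<lambda>n. reduce_mod (fibotomic n) :: 'p mod_ring poly"
  have p: "prime ?p" by (rule prime_card)
  have p0: "?p > 0" using p by (rule prime_gt_0_nat)
  have ch: "CHAR('p mod_ring poly) = ?p" by simp
  have frob: "fibo ?X (?p ^ i * m) = fibo ?X m ^ (?p ^ i) * fibo ?X (?p ^ i)" if "m > 0" for i m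
    using fibo_char_power_mult[of "?p ^ i" i m ?X] that p ch by simp
  have tot: "totient (?p ^ k) + ?p ^ j = ?p ^ k"
    unfolding Suc by (rule totient_prime_power_add[OF p])
  have eq: "(\<Prod>d | d dvd m. ?P (?p ^ k * d)) = fibo ?X m ^ totient (?p ^ k) * ?P (?p ^ k)"
    if m: "m > 0" and copm: "coprime ?p m" for m
  proof -
    have "(\<Prod>d | d dvd ?p ^ k * m. ?P d)
       = (\<Prod>d | d dvd ?p ^ j * m. ?P d) * (\<Prod>d\<in>(*) (?p ^ k) ` {d. d dvd m}. ?P d)"
      using divisors_prime_power_mult[OF p copm, of j] m p0 unfolding Suc
      by (simp only:) (rule prod.union_disjoint, auto simp: finite_divisors_nat)
    also have "(\<Prod>d\<in>(*) (?p ^ k) ` {d. d dvd m}. ?P d) = (\<Prod>d | d dvd m. ?P (?p ^ k * d))"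
      using p0 by (subst prod.reindex) (auto simp: inj_on_def)
    finally have "fibo ?X (?p ^ j * m) * (\<Prod>d | d dvd m. ?P (?p ^ k * d)) = fibo ?X (?p ^ k * m)"
      using m p0 by (simp only: prod_reduce_fibotomic zero_less_power nat_0_less_mult_iff)
    also have "\<dots> = fibo ?X m ^ (?p ^ k) * fibo ?X (?p ^ k)" by (rule frob[OF m])
    \<comment> \<open>Splitting the exponent \<open>p^k\<close> exposes \<open>F\<close> at
      \<open>p^j m\<close> as a common factor to cancel.\<close>
    also have "\<dots> = fibo ?X m ^ (totient (?p ^ k) + ?p ^ j) * (?P (?p ^ k) * fibo ?X (?p ^ j))"
      unfolding tot reduce_fibotomic_prime_power[symmetric, of j, where 'p = 'p, folded Suc] ..
    also have "\<dots> = fibo ?X (?p ^ j * m) * (fibo ?X m ^ totient (?p ^ k) * ?P (?p ^ k))"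
      unfolding frob[OF m] by (simp only: power_add mult_ac)
    finally show ?thesis
      using fibo_poly_nonzero[where 'a = "'p mod_ring", of "?p ^ j * m"] m p0 by simp
  qed
  \<comment> \<open>The divisor 1 is exceptional: \<open>fibotomic 1 = 1\<close> has no power to
    account for \<open>?P (?p ^ k)\<close>, which is therefore inserted there. Since
    \<open>n \<ge> 2\<close>, the value at \<open>n\<close> has the plain form.\<close>
  let ?g = "\<lambda>d. ?P d ^ totient (?p ^ k) * (if d = 1 then ?P (?p ^ k) else 1)"
  have "?P (?p ^ k * n) = ?g n"
  proof (rule prod_divisors_unique[of n "\<lambda>d. ?P (?p ^ k * d)" ?g])
    fix m assume m: "m dvd n"
    have m0: "m > 0" using m n by (auto intro: Nat.gr0I)
    have copm: "coprime ?p m" using m cop by (meson coprime_divisors dvd_refl)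
    have fin: "finite {d. d dvd m}" using m0 by (auto simp: finite_divisors_nat)
    have "(\<Prod>d | d dvd m. ?g d)
      = (\<Prod>d | d dvd m. ?P d) ^ totient (?p ^ k) * (\<Prod>d | d dvd m. if d = 1 then ?P (?p ^ k) else 1)"
      by (simp only: prod.distrib prod_power_distrib)
    also have "(\<Prod>d | d dvd m. if d = 1 then ?P (?p ^ k) else 1) = ?P (?p ^ k)"
      using fin by (subst prod.delta) auto
    also have "(\<Prod>d | d dvd m. ?P d) = fibo ?X m" by (rule prod_reduce_fibotomic[OF m0])
    finally show "(\<Prod>d | d dvd m. ?P (?p ^ k * d)) = (\<Prod>d | d dvd m. ?g d)"
      unfolding eq[OF m0 copm] ..
  qed (use n reduce_fibotomic_nonzero in auto)
  then show ?thesis using n by simp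
qed simp

text \<open>\<open>F\<close> at \<open>p^i\<close> is \<open>x^2 + 4\<close> to the power
  \<open>(p^i - 1) / 2\<close>, and consecutive exponents differ by half of the totient.\<close>

lemma reduce_fibotomic_prime_power_odd:
  assumes odd: "odd CARD('p)" and k: "k > 0"
  shows "reduce_mod (fibotomic (CARD('p) ^ k))
    = ([:4, 0, 1:] :: 'p::prime_card mod_ring poly) ^ (totient (CARD('p) ^ k) div 2)"
proof -
  let ?p = "CARD('p)" and ?X = "[:0, 1 :: 'p mod_ring:]"
  have p: "prime ?p" by (rule prime_card)
  have p0: "?p > 0" using p by (rule prime_gt_0_nat)
  obtain j where j: "k = Suc j" using k by (cases k) auto
  have X: "?X ^ 2 + 4 = [:4, 0, 1:]" by (simp add: power2_eq_square numeral_poly)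
  have F: "fibo ?X (?p ^ i) = [:4, 0, 1:] ^ (?p ^ i div 2)" for i
    using fibo_luc_char_power_odd(1)[of "?p ^ i" i ?X] p odd X by simp
  have tot: "totient (?p ^ k) + ?p ^ j = ?p ^ k"
    unfolding j by (rule totient_prime_power_add[OF p])
  have "odd (?p ^ k)" "odd (?p ^ j)" using odd by auto
  moreover have "a div 2 = t div 2 + b div 2" if "t + b = a" "odd a" "odd b" for a b t :: nat
    using that by presburger
  ultimately have "?p ^ k div 2 = totient (?p ^ k) div 2 + ?p ^ j div 2"
    using tot by blast
  then have "reduce_mod (fibotomic (?p ^ k)) * [:4, 0, 1:] ^ (?p ^ j div 2)
    = ([:4, 0, 1:] :: 'p mod_ring poly) ^ (totient (?p ^ k) div 2) * [:4, 0, 1:] ^ (?p ^ j div 2)"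
    using reduce_fibotomic_prime_power[of j, where 'p = 'p, folded j] unfolding F
    by (simp only: power_add)
  then show ?thesis by simp
qed

lemma reduce_fibotomic_prime_power_two:
  assumes two: "CARD('p) = 2" and k: "k > 0"
  shows "reduce_mod (fibotomic (2 ^ k))
    = ([:0, 1:] :: 'p::prime_card mod_ring poly) ^ totient (2 ^ k)"
proof -
  let ?X = "[:0, 1 :: 'p mod_ring:]"
  obtain j where j: "k = Suc j" using k by (cases k) auto
  have ch: "CHAR('p mod_ring poly) = 2" using two by simp
  have F: "fibo ?X (2 ^ i) = ?X ^ (2 ^ i - 1)" for i
    using fibo_luc_char_power_two(1)[OF ch] .
  have e: "2 ^ k - 1 = totient (2 ^ k) + (2 ^ j - 1)"
    using totient_prime_power_add[OF two_is_prime_nat, of j] one_le_power[of "2 :: nat" j]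
    unfolding j by linarith
  have "reduce_mod (fibotomic (2 ^ k)) * ?X ^ (2 ^ j - 1) = ?X ^ totient (2 ^ k) * ?X ^ (2 ^ j - 1)"
    using reduce_fibotomic_prime_power[of j, where 'p = 'p, folded j] unfolding F two e
    by (simp only: power_add)
  then show ?thesis by simp
qed

section \<open>The exponents \<open>\<delta>\<close>\<close>

text \<open>If the order divides \<open>2 d\<close> but not \<open>d\<close>, the cofactor is odd,
  so \<open>d\<close> is an odd multiple of half the order. Conditions on \<open>p^d\<close> can
  thus be tested at that half.\<close>

lemma ord_dvd_double_cases:
  fixes p N d :: nat
  assumes "ord N p dvd 2 * d" "\<not> ord N p dvd d"
  shows "even (ord N p)" "odd (d div (ord N p div 2))" "d = (d div (ord N p div 2)) * (ord N p div 2)"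
    and "[p ^ d = p ^ (ord N p div 2)] (mod N)"
proof -
  let ?u = "ord N p"
  obtain c where c: "2 * d = ?u * c" using assms(1) by blast
  have oc: "odd c"
  proof
    assume "even c"
    then obtain e where "c = 2 * e" by blast
    then have "d = ?u * e" using c by simp
    then show False using assms(2) by simp
  qed
  have "even (?u * c)" using c by (metis dvd_triv_left)
  then show eu: "even ?u" using oc by simp
  then obtain v where v: "?u = 2 * v" by blast
  have d: "d = v * c" using c v by simp
  have v0: "v > 0" using assms v d by (auto intro: Nat.gr0I)
  show "odd (d div (?u div 2))" "d = (d div (?u div 2)) * (?u div 2)"
    using d v v0 oc by auto
  obtain e where e: "c = 2 * e + 1" using oc by (rule oddE)
  have "[(p ^ ?u) ^ e = 1 ^ e] (mod N)" by (intro cong_pow ord)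
  then have "[(p ^ ?u) ^ e * p ^ v = 1 * p ^ v] (mod N)" by (intro cong_mult) auto
  moreover have "p ^ d = (p ^ ?u) ^ e * p ^ v"
    unfolding d e v by (simp add: power_add power_mult algebra_simps flip: power_mult)
  ultimately show "[p ^ d = p ^ (?u div 2)] (mod N)" using v by simp
qed

lemma ord_div_two_le:
  fixes p N d :: nat
  assumes "ord N p dvd 2 * d" "d > 0"
  shows "ord N p div 2 \<le> d"
  using assms dvd_imp_le[of "ord N p" "2 * d"] by simp

text \<open>Squaring -1 gives 1, and 1 differs from -1 because \<open>N > 2\<close>.\<close>

lemma cong_minus_one_ord:
  fixes p N d :: nat
  assumes N: "N > 2" and c: "[p ^ d + 1 = 0] (mod N)"
  shows "ord N p dvd 2 * d" "\<not> ord N p dvd d"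
proof -
  have "[int (p ^ d) + 1 = 0] (mod int N)"
    using c by (metis cong_int_iff of_nat_0 of_nat_1 of_nat_add)
  then have i: "int N dvd int (p ^ d) + 1" by (simp add: cong_0_iff)
  then have "int N dvd (int (p ^ d) + 1) * (int (p ^ d) - 1)" by simp
  also have "\<dots> = int (p ^ (2 * d)) - int 1"
    by (simp add: algebra_simps power_add mult_2_right)
  finally have "[p ^ (2 * d) = 1] (mod N)"
    by (simp only: cong_int_iff[symmetric] cong_iff_dvd_diff)
  then show "ord N p dvd 2 * d" by (simp only: ord_divides)
  show "\<not> ord N p dvd d"
  proof
    assume "ord N p dvd d"
    then have "[p ^ d = 1] (mod N)" by (simp only: ord_divides)
    then have "int N dvd int (p ^ d) - 1"
      by (metis cong_iff_dvd_diff cong_int_iff of_nat_1)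
    then have "int N dvd (int (p ^ d) + 1) - (int (p ^ d) - 1)" using i by (rule dvd_diff[rotated])
    then have "int N dvd 2" by simp
    then show False using N by (auto dest: zdvd_imp_le)
  qed
qed

text \<open>As \<open>p\<close> is odd, \<open>m\<close> is forced to be even, and then the squares
  of \<open>m + 1\<close> and \<open>m - 1\<close> are 1 modulo \<open>2 m\<close>. Neither number
  is 1 itself, since \<open>2 m\<close> divides neither \<open>m\<close> nor
  \<open>m - 2\<close>.\<close>

lemma cong_half_ord:
  fixes p m d :: nat
  assumes m: "m \<ge> 3" and p: "odd p" and c: "[p ^ d = m + 1] (mod 2 * m) \<or> [p ^ d = m - 1] (mod 2 * m)"
  shows "ord (2 * m) p dvd 2 * d" "\<not> ord (2 * m) p dvd d"
proof -
  obtain e :: int where e: "e = 1 \<or> e = -1" and i: "int (2 * m) dvd int (p ^ d) - (int m + e)"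
  proof -
    from c show ?thesis
    proof
      assume "[p ^ d = m + 1] (mod 2 * m)"
      then have "int (2 * m) dvd int (p ^ d) - int (m + 1)"
        by (simp only: cong_int_iff[symmetric] cong_iff_dvd_diff)
      then show ?thesis using that[of 1] by (simp add: add.commute)
    next
      assume "[p ^ d = m - 1] (mod 2 * m)"
      then have "int (2 * m) dvd int (p ^ d) - int (m - 1)"
        by (simp only: cong_int_iff[symmetric] cong_iff_dvd_diff)
      then show ?thesis using that[of "-1"] m by (simp add: of_nat_diff)
    qed
  qed
  obtain t where "int (p ^ d) - (int m + e) = int (2 * m) * t"
    using i unfolding dvd_def by blast
  then have t: "int (p ^ d) = int m + e + 2 * int m * t" by (simp add: algebra_simps)
  have "odd (int (p ^ d))" using p by simp
  then have "even (int m)" unfolding t using e by auto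
  then obtain h where h: "int m = 2 * h" by blast
  have e2: "e * e = 1" using e by auto
  have "int (p ^ (2 * d)) - int 1 = int (p ^ d) * int (p ^ d) - 1"
    by (simp add: power_add mult_2)
  \<comment> \<open>The summand \<open>h\<close> accounts for \<open>m^2 = 2 m h\<close>.\<close>
  also have "\<dots> = int (2 * m) * (h + e + 2 * int m * t * t + 2 * int m * t + 2 * e * t)"
    unfolding t using e2 h by (simp add: algebra_simps)
  finally have "int (2 * m) dvd int (p ^ (2 * d)) - int 1" by simp
  then have "[p ^ (2 * d) = 1] (mod 2 * m)"
    by (simp only: cong_int_iff[symmetric] cong_iff_dvd_diff)
  then show "ord (2 * m) p dvd 2 * d" by (simp only: ord_divides)
  show "\<not> ord (2 * m) p dvd d"
  proof
    assume "ord (2 * m) p dvd d"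
    then have "[p ^ d = 1] (mod 2 * m)" by (simp only: ord_divides)
    then have "int (2 * m) dvd int (p ^ d) - 1"
      by (metis cong_iff_dvd_diff cong_int_iff of_nat_1)
    then have "int (2 * m) dvd (int (p ^ d) - 1) - (int (p ^ d) - (int m + e))"
      using i by (rule dvd_diff)
    then have "int (2 * m) dvd int m + e - 1" by (simp add: algebra_simps)
    then show False using e m by (auto dest: zdvd_imp_le)
  qed
qed

lemma prime_power_mod_4:
  fixes p :: nat
  shows "p mod 4 = 1 \<Longrightarrow> p ^ d mod 4 = 1"
    and "p mod 4 = 3 \<Longrightarrow> p ^ d mod 4 = (if even d then 1 else 3)"
proof -
  show "p mod 4 = 1 \<Longrightarrow> p ^ d mod 4 = 1"
    by (induction d) (auto simp: mod_mult_left_eq[symmetric, of p] mod_mult_right_eq[symmetric, of p])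
  show "p mod 4 = 3 \<Longrightarrow> p ^ d mod 4 = (if even d then 1 else 3)"
  proof (induction d)
    case (Suc d)
    have "p ^ Suc d mod 4 = (p mod 4) * (p ^ d mod 4) mod 4" by (simp add: mod_mult_eq)
    then show ?case using Suc by auto
  qed simp
qed

text \<open>
  For \<open>s = p\<^sup>d\<close> with \<open>p\<close> odd, this is the condition for a prime of rank \<open>m\<close> to divide \<open>x\<^sup>s - x\<close>.
\<close>

definition frob_cond :: "nat \<Rightarrow> nat \<Rightarrow> bool" where
  "frob_cond s m \<longleftrightarrow> (if s mod 4 = 1 then [s = 1] (mod 2 * m) \<or> [s + 1 = 0] (mod 2 * m)
     else [s = m + 1] (mod 2 * m) \<or> [s = m - 1] (mod 2 * m))"

text \<open>Any exponent satisfying \<open>R\<close> or \<open>S\<close> reduces to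
  \<open>u div 2\<close>, so only \<open>u div 2\<close>, \<open>u\<close> and \<open>2 * u\<close>
  can be least. For \<open>p\<close> congruent to 3 modulo 4, the parity of the exponent decides
  which condition applies.\<close>

lemma delta_odd_least:
  fixes p m :: nat
  assumes m: "m \<ge> 3" and p: "odd p" and cop: "coprime p m"
  shows "delta_odd p m > 0" and "frob_cond (p ^ delta_odd p m) m"
    and "d > 0 \<Longrightarrow> frob_cond (p ^ d) m \<Longrightarrow> delta_odd p m \<le> d"
proof -
  define u where "u = ord (2 * m) p"
  have cop2: "coprime (2 * m) p" 
    using cop p algebraic_semidom_class.coprime_commute[of p m] by simp
  then have u0: "u > 0" unfolding u_def by simp
  have one: "[p ^ d = 1] (mod 2 * m) \<longleftrightarrow> u dvd d" for d unfolding u_def by (rule ord_divides)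
  define R where "R d \<longleftrightarrow> [p ^ d + 1 = 0] (mod 2 * m)" for d
  define S where "S d \<longleftrightarrow> [p ^ d = m + 1] (mod 2 * m) \<or> [p ^ d = m - 1] (mod 2 * m)" for d
  have RS: "u dvd 2 * d \<and> \<not> u dvd d" if "R d \<or> S d" for d
    using that cong_minus_one_ord[of "2 * m" p d] cong_half_ord[of m p d] m p
    unfolding u_def R_def S_def by auto
  \<comment> \<open>\<open>R\<close> and \<open>S\<close> depend only on \<open>p^d\<close>, which
    is congruent to \<open>p ^ (u div 2)\<close>; the parities agree because \<open>d\<close> is an
    odd multiple of \<open>u div 2\<close>.\<close>
  have RS2: "even u \<and> (R d \<longleftrightarrow> R (u div 2)) \<and> (S d \<longleftrightarrow> S (u div 2))
     \<and> (even d \<longleftrightarrow> even (u div 2)) \<and> u div 2 \<le> d"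
    if "R d \<or> S d" "d > 0" for d
  proof -
    note * = ord_dvd_double_cases[of "2 * m" p d, folded u_def, OF RS[OF that(1), THEN conjunct1] RS[OF that(1), THEN conjunct2]]
    have "R d \<longleftrightarrow> R (u div 2)" "S d \<longleftrightarrow> S (u div 2)"
      unfolding R_def S_def using *(4)
      by (meson cong_add_rcancel_nat cong_sym cong_trans)+
    moreover have "even d \<longleftrightarrow> even (u div 2)" using *(2,3) by (metis even_mult_iff)
    moreover have "u div 2 \<le> d"
      using ord_div_two_le[of "2 * m" p d] RS[OF that(1)] that(2) unfolding u_def by blast
    ultimately show ?thesis using *(1) by blast
  qed
  have u2: "u div 2 > 0" if "even u" using that u0 by (auto elim: evenE)
  have cond: "frob_cond (p ^ d) m \<longleftrightarrow> (if p ^ d mod 4 = 1 then u dvd d \<or> R d else S d)" for d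
    unfolding frob_cond_def R_def S_def one ..
  have half_le: "u div 2 \<le> d" if "u dvd d \<or> R d \<or> S d" "d > 0" for d
  proof (cases "u dvd d")
    case True
    then show ?thesis using dvd_imp_le[of u d] that(2) by linarith
  next
    case False
    then show ?thesis using RS2[of d] that by metis
  qed
  have full_le: "u \<le> d" if "u dvd d" "d > 0" for d
    using that by (rule dvd_imp_le)
  have "p mod 4 = 1 \<or> p mod 4 = 3" using p by presburger
  then consider "p mod 4 = 1" | "p mod 4 = 3" by blast
  then have "delta_odd p m > 0 \<and> frob_cond (p ^ delta_odd p m) m
    \<and> (\<forall>d. d > 0 \<longrightarrow> frob_cond (p ^ d) m \<longrightarrow> delta_odd p m \<le> d)"
  proof cases
    case 1
    have cond1: "frob_cond (p ^ d) m \<longleftrightarrow> u dvd d \<or> R d" for d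
      unfolding cond using prime_power_mod_4(1)[OF 1] by simp
    have delta: "delta_odd p m = (if even u \<and> R (u div 2) then u div 2 else u)"
      unfolding delta_odd_def Let_def u_def[symmetric] R_def using 1 by (simp add: cong_def)
    show ?thesis
    proof (cases "even u \<and> R (u div 2)")
      case True
      have "u div 2 \<le> d" if "u dvd d \<or> R d" "d > 0" for d
        using half_le[of d] that by metis
      then show ?thesis unfolding delta cond1 using True u2 by auto
    next
      case False
      have "u \<le> d" if "u dvd d \<or> R d" "d > 0" for d
        using full_le[of d] that RS2[of d] False by metis
      then show ?thesis unfolding delta cond1 using False u0 by auto
    qed
  next
    case 2
    have cond3: "frob_cond (p ^ d) m \<longleftrightarrow> (if even d then u dvd d \<or> R d else S d)" for d
      unfolding cond using prime_power_mod_4(2)[OF 2, of d] by simp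
    have delta: "delta_odd p m = (if (u mod 4 = 0 \<and> R (u div 2)) \<or> (u mod 4 = 2 \<and> S (u div 2))
        then u div 2 else if odd u then 2 * u else u)"
      unfolding delta_odd_def Let_def u_def[symmetric] R_def S_def using 2 by (auto simp: cong_def)
    have "odd u \<or> u mod 4 = 0 \<or> u mod 4 = 2" by presburger
    then consider "odd u" | "u mod 4 = 0" | "u mod 4 = 2" by metis
    then show ?thesis
    proof cases
      case 1
      have "u mod 4 \<noteq> 0" "u mod 4 \<noteq> 2" using 1 by presburger+
      then have delta: "delta_odd p m = 2 * u" unfolding delta using 1 by simp
      \<comment> \<open>An odd order excludes both \<open>R\<close> and \<open>S\<close>, which
        leaves the even multiples of \<open>u\<close>.\<close>
      have "2 * u \<le> d" if d: "frob_cond (p ^ d) m" "d > 0" for d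
      proof -
        have "\<not> R d" "\<not> S d" using RS2[of d] 1 d(2) by auto
        then have "even d" "u dvd d" using d unfolding cond3 by (auto split: if_splits)
        then have "2 * u dvd d" using 1 by (intro divides_mult) auto
        then show ?thesis using d(2) by (rule dvd_imp_le)
      qed
      then show ?thesis unfolding delta using u0 by (auto simp: cond3)
    next
      case 2
      then have "even u" "even (u div 2)" by presburger+
      \<comment> \<open>\<open>S\<close> at an odd exponent would make \<open>u div 2\<close>
        odd.\<close>
      then have S: "\<not> S d" if "odd d" "d > 0" for d using that RS2[of d] by auto
      show ?thesis
      proof (cases "R (u div 2)")
        case True
        then have delta: "delta_odd p m = u div 2" unfolding delta using 2 by simp
        have "u div 2 \<le> d" if "frob_cond (p ^ d) m" "d > 0" for d
          using half_le[of d] that unfolding cond3 by metis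
        then show ?thesis
          unfolding delta using u2 \<open>even u\<close> \<open>even (u div 2)\<close> True by (auto simp: cond3)
      next
        case False
        then have delta: "delta_odd p m = u" unfolding delta using 2 \<open>even u\<close> by simp
        have "u \<le> d" if "frob_cond (p ^ d) m" "d > 0" for d
          using full_le[of d] that RS2[of d] S[of d] False unfolding cond3 by metis
        then show ?thesis unfolding delta using u0 \<open>even u\<close> by (auto simp: cond3)
      qed
    next
      case 3
      then have "even u" "odd (u div 2)" by presburger+
      \<comment> \<open>\<open>R\<close> at an even exponent would make \<open>u div 2\<close>
        even.\<close>
      then have R: "\<not> R d" if "even d" "d > 0" for d using that RS2[of d] by auto
      show ?thesis
      proof (cases "S (u div 2)")
        case True
        then have delta: "delta_odd p m = u div 2" unfolding delta using 3 by simp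
        have "u div 2 \<le> d" if "frob_cond (p ^ d) m" "d > 0" for d
          using half_le[of d] that unfolding cond3 by metis
        then show ?thesis
          unfolding delta using u2 \<open>even u\<close> \<open>odd (u div 2)\<close> True by (auto simp: cond3)
      next
        case False
        then have delta: "delta_odd p m = u" unfolding delta using 3 \<open>even u\<close> by simp
        have "u \<le> d" if "frob_cond (p ^ d) m" "d > 0" for d
          using full_le[of d] that RS2[of d] R[of d] False unfolding cond3 by metis
        then show ?thesis unfolding delta using u0 \<open>even u\<close> by (auto simp: cond3)
      qed
    qed
  qed
  then show "delta_odd p m > 0" "frob_cond (p ^ delta_odd p m) m"
    "d > 0 \<Longrightarrow> frob_cond (p ^ d) m \<Longrightarrow> delta_odd p m \<le> d" by auto
qed

text \<open>The same reduction to half the order, now modulo \<open>m\<close> and without a parity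
  condition on the exponent.\<close>

lemma delta_two_least:
  fixes m :: nat
  assumes m: "m \<ge> 3" and cop: "odd m"
  shows "delta_two m > 0" and "[2 ^ delta_two m = 1] (mod m) \<or> [2 ^ delta_two m + 1 = 0] (mod m)"
    and "d > 0 \<Longrightarrow> [2 ^ d = 1] (mod m) \<or> [2 ^ d + 1 = 0] (mod m) \<Longrightarrow> delta_two m \<le> d"
proof -
  define u where "u = ord m 2"
  have u0: "u > 0" unfolding u_def using cop by simp
  have one: "[2 ^ d = 1] (mod m) \<longleftrightarrow> u dvd d" for d unfolding u_def by (rule ord_divides)
  have u2: "u div 2 > 0" if "even u" using that u0 by (auto elim: evenE)
  have delta: "delta_two m = (if even u \<and> [2 ^ (u div 2) + 1 = 0] (mod m) then u div 2 else u)"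
    unfolding delta_two_def Let_def u_def ..
  show "delta_two m > 0" unfolding delta using u0 u2 by auto
  show "[2 ^ delta_two m = 1] (mod m) \<or> [2 ^ delta_two m + 1 = 0] (mod m)"
    unfolding delta one by auto
  assume d: "d > 0" and c: "[2 ^ d = 1] (mod m) \<or> [2 ^ d + 1 = 0] (mod m)"
  have le: "delta_two m \<le> u" unfolding delta by auto
  show "delta_two m \<le> d"
  proof (cases "u dvd d")
    case True
    then show ?thesis using dvd_imp_le[of u d] d le by simp
  next
    case False
    then have R: "[2 ^ d + 1 = 0] (mod m)" using c one by blast
    have ud: "u dvd 2 * d"
      using cong_minus_one_ord(1)[OF _ R] m unfolding u_def by simp
    note * = ord_dvd_double_cases[of m 2 d, folded u_def, OF ud False]
    have "[2 ^ (u div 2) + 1 = 0] (mod m)"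
      using *(4) R by (meson cong_add_rcancel_nat cong_sym cong_trans)
    then have "delta_two m = u div 2" using *(1) unfolding delta by simp
    then show ?thesis using ord_div_two_le[of m 2 d] ud d unfolding u_def by simp
  qed
qed

section \<open>Irreducible factors and their ranks\<close>

lemma dvd_of_nat_coprime_imp_unit:
  fixes q :: "'p::prime_card mod_ring poly"
  assumes "q dvd of_nat n" "coprime CARD('p) n"
  shows "q dvd 1"
proof -
  have p: "prime CARD('p)" by (rule prime_card)
  have "\<not> CARD('p) dvd n"
    using assms(2) p by (metis coprime_absorb_left not_prime_unit)
  then have "(of_nat n :: 'p mod_ring) \<noteq> 0"
    using of_nat_eq_0_iff_char_dvd[where 'a = "'p mod_ring", of n] by simp
  then have "(of_nat n :: 'p mod_ring poly) dvd 1"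
    by (simp add: of_nat_poly is_unit_const_poly_iff dvd_field_iff)
  with assms(1) show ?thesis by (rule dvd_trans)
qed

lemma dvd_fibo_odd_char:
  fixes q :: "'p::prime_card mod_ring poly"
  assumes q: "prime_elem q" and odd: "odd CARD('p)" and cop: "coprime CARD('p) n"
    and F: "q dvd fibo [:0, 1:] n"
  shows "\<not> q dvd [:0, 1:] ^ 2 + 4" "\<not> q ^ 2 dvd fibo [:0, 1:] n"
proof -
  have "coprime CARD('p) (2 * n)" using odd cop by simp
  moreover have "\<not> q dvd 1" using q unfolding prime_elem_def by blast
  ultimately have "\<not> q dvd of_nat (2 * n)" using dvd_of_nat_coprime_imp_unit by blast
  then show "\<not> q dvd [:0, 1:] ^ 2 + 4" "\<not> q ^ 2 dvd fibo [:0, 1:] n"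
    using dvd_fibo_imp_dvd_of_nat[OF q F] by blast+
qed

lemma prime_elem_dvd_prod:
  assumes q: "prime_elem q"
  shows "finite A \<Longrightarrow> q dvd (\<Prod>a\<in>A. g a) \<Longrightarrow> \<exists>a\<in>A. q dvd g a"
proof (induction A rule: finite_induct)
  case empty
  then show ?case using q by (simp add: prime_elem_def)
next
  case (insert a A)
  then show ?case using prime_elem_dvd_mult_iff[OF q] by auto
qed

text \<open>\<open>G\<close> stands for \<open>F\<close> in odd characteristic and for its square
  root in characteristic two. A rank \<open>r\<close> below \<open>m\<close> would place
  \<open>q\<close> in both \<open>g m\<close> and some \<open>g d\<close> with
  \<open>d dvd r\<close>, and \<open>q ^ 2\<close> would divide \<open>G m\<close>.\<close>

lemma primitive_factor_rank:
  fixes g G :: "nat \<Rightarrow> 'a::idom poly"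
  assumes q: "prime_elem q" and m: "m > 0"
    and prod: "\<And>n. n dvd m \<Longrightarrow> (\<Prod>d | d dvd n. g d) = G n"
    and dvd_iff: "\<And>n. n dvd m \<Longrightarrow> q dvd G n \<longleftrightarrow> q dvd fibo x n"
    and sq: "\<not> q ^ 2 dvd G m" and qg: "q dvd g m"
  shows "q dvd fibo x n \<longleftrightarrow> m dvd n"
proof -
  have fin: "finite {d. d dvd m}" using m by (simp add: finite_divisors_nat)
  have "g m dvd G m" unfolding prod[OF dvd_refl, symmetric] using fin by (intro dvd_prodI) auto
  then have "q dvd G m" using dvd_trans[OF qg] by blast
  then have "q dvd fibo x m" using dvd_iff[OF dvd_refl] by blast
  then obtain r where r: "r > 0" "r dvd m" "q dvd fibo x r"
    "\<And>k. 0 < k \<Longrightarrow> k < r \<Longrightarrow> \<not> q dvd fibo x k"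
    using fibo_rank_exists[OF q m] by metis
  have "r = m"
  proof (rule ccontr)
    assume "r \<noteq> m"
    then have rm: "r < m" using dvd_imp_le[OF r(2) m] by simp
    have "q dvd (\<Prod>d | d dvd r. g d)" unfolding prod[OF r(2)] dvd_iff[OF r(2)] by (rule r(3))
    moreover have "finite {d. d dvd r}" using r(1) by (simp add: finite_divisors_nat)
    ultimately obtain d where d: "d dvd r" "q dvd g d"
      using prime_elem_dvd_prod[OF q] by blast
    have "d \<noteq> m" using d rm r(1) by (auto dest: dvd_imp_le)
    then have "(\<Prod>d\<in>{d, m}. g d) dvd G m"
      unfolding prod[OF dvd_refl, symmetric]
      using fin dvd_trans[OF d(1) r(2)] by (intro prod_dvd_prod_subset) simp_all
    moreover have "q ^ 2 dvd (\<Prod>d\<in>{d, m}. g d)"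
      using d qg \<open>d \<noteq> m\<close> by (simp add: power2_eq_square mult_dvd_mono)
    ultimately show False using sq dvd_trans by blast
  qed
  then show ?thesis using prime_elem_dvd_fibo_iff[OF q r(1) r(3)] r(4) by blast
qed

section \<open>Square roots in characteristic two\<close>

text \<open>For odd \<open>n\<close> in characteristic two, squaring is additive and
  \<open>fibo_odd\<close> makes this the square root of \<open>F_n\<close>.\<close>

definition fibo_sqrt :: "'a::comm_ring_1 \<Rightarrow> nat \<Rightarrow> 'a" where
  "fibo_sqrt x n = fibo x (Suc (n div 2)) + fibo x (n div 2)"

lemma fibo_sqrt_square:
  fixes x :: "'a::idom"
  assumes "CHAR('a) = 2" "odd n"
  shows "fibo_sqrt x n ^ 2 = fibo x n"
proof -
  have "fibo x n = fibo x (Suc (n div 2)) ^ 2 + fibo x (n div 2) ^ 2"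
    using fibo_odd[of x "n div 2"] assms(2) by simp
  also have "\<dots> = fibo_sqrt x n ^ 2"
    unfolding fibo_sqrt_def by (simp add: power2_sum char_two_facts[OF assms(1)])
  finally show ?thesis ..
qed

text \<open>With \<open>j = n div 2\<close>, the root \<open>G\<close> and its derivative satisfy
  \<open>x G' = j G + F_j\<close> in characteristic two. A double factor of \<open>G\<close> would
  divide \<open>F_j\<close>, hence also \<open>F_(j+1)\<close>.\<close>

lemma fibo_sqrt_squarefree:
  fixes q :: "'a::idom poly"
  assumes ch: "CHAR('a) = 2" and q: "prime_elem q"
  shows "\<not> q ^ 2 dvd fibo_sqrt [:0, 1:] n"
proof
  assume sq: "q ^ 2 dvd fibo_sqrt [:0, 1:] n"
  let ?X = "[:0, 1 :: 'a:]" and ?j = "n div 2"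
  let ?G = "fibo_sqrt ?X n"
  have ch': "CHAR('a poly) = 2" using ch by simp
  note ct = char_two_facts[OF ch']
  have sub: "a - b = a + b" for a b :: "'a poly" using ct(2)[of b] by (metis diff_conv_add_uminus)
  have four: "(4 :: 'a poly) = 0" using ct(1) by (metis mult_zero_left numeral_Bit0 numeral_One mult_2 add_0)
  \<comment> \<open>Here \<open>x^2 + 4\<close> is \<open>x^2\<close> and \<open>L_i\<close> is
    \<open>x F_i\<close>, so a factor \<open>x\<close> cancels from
    \<open>pderiv_fibo\<close>.\<close>
  have der: "?X * pderiv (fibo ?X i) = (of_nat i + 1) * fibo ?X i" for i
  proof -
    have "?X * (?X * pderiv (fibo ?X i)) = ?X * ((of_nat i + 1) * fibo ?X i)"
      using pderiv_fibo[of i, where 'a = 'a] unfolding fibo_luc_char_power_two(2)[OF ch'] four sub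
      by (simp only: power2_eq_square add_0_right mult.assoc) (simp only: algebra_simps mult_1)
    then show ?thesis by (simp only: mult_cancel_left) auto
  qed
  have "?X * pderiv ?G = of_nat ?j * ?G + fibo ?X ?j"
    unfolding fibo_sqrt_def pderiv_add distrib_left der
    by (simp add: algebra_simps ct(1))
  moreover obtain h where h: "?G = q ^ 2 * h" using sq unfolding dvd_def by blast
  moreover have "q dvd pderiv ?G" unfolding h by (simp add: pderiv_mult power2_eq_square)
  moreover have qG: "q dvd ?G" unfolding h by (simp add: power2_eq_square)
  ultimately have j: "q dvd fibo ?X ?j"
    by (metis dvd_add_right_iff dvd_mult)
  then have "q dvd fibo ?X (Suc ?j)" using qG unfolding fibo_sqrt_def by (simp add: dvd_add_left_iff)
  with j have "q dvd 1" by (rule fibo_consecutive)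
  then show False using q unfolding prime_elem_def by blast
qed

text \<open>By induction the factors at proper divisors are squares. Their root divides the root of
  \<open>F_n\<close>, so the remaining factor is a square too.\<close>

lemma reduce_fibotomic_square:
  assumes two: "CARD('p) = 2" and n: "odd n"
  shows "\<exists>h. reduce_mod (fibotomic n) = (h :: 'p::prime_card mod_ring poly) ^ 2"
  using n
proof (induction n rule: less_induct)
  case (less n)
  let ?P = "\<lambda>n. reduce_mod (fibotomic n) :: 'p mod_ring poly" and ?X = "[:0, 1 :: 'p mod_ring:]"
  have ch: "CHAR('p mod_ring poly) = 2" using two by simp
  let ?D = "{d. d dvd n} - {n}"
  have n0: "n > 0" using less.prems by (auto intro: Nat.gr0I)
  have fin: "finite {d. d dvd n}" using n0 by (simp add: finite_divisors_nat)
  have "\<exists>h. ?P d = h ^ 2" if "d \<in> ?D" for d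
  proof (rule less.IH)
    show "d < n" using that n0 dvd_imp_le[of d n] by auto
    show "odd d" using that less.prems by (auto intro: dvd_trans)
  qed
  then obtain h where h: "\<And>d. d \<in> ?D \<Longrightarrow> ?P d = h d ^ 2" by metis
  have "fibo_sqrt ?X n ^ 2 = ?P n * (\<Prod>d\<in>?D. ?P d)"
    using prod_reduce_fibotomic[OF n0, where 'a = 'p] prod.remove[OF fin, of n ?P]
    by (simp add: fibo_sqrt_square[OF ch less.prems])
  also have "(\<Prod>d\<in>?D. ?P d) = (\<Prod>d\<in>?D. h d) ^ 2"
    unfolding prod_power_distrib by (rule prod.cong) (use h in auto)
  finally have eq: "fibo_sqrt ?X n ^ 2 = ?P n * (\<Prod>d\<in>?D. h d) ^ 2" .
  then have "(\<Prod>d\<in>?D. h d) ^ 2 dvd fibo_sqrt ?X n ^ 2" by simp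
  then have "(\<Prod>d\<in>?D. h d) dvd fibo_sqrt ?X n" by simp
  then obtain c where c: "fibo_sqrt ?X n = (\<Prod>d\<in>?D. h d) * c" by blast
  have "(\<Prod>d\<in>?D. ?P d) \<noteq> 0" using fin reduce_fibotomic_nonzero by auto
  then have "(\<Prod>d\<in>?D. h d) ^ 2 \<noteq> 0" using \<open>(\<Prod>d\<in>?D. ?P d) = (\<Prod>d\<in>?D. h d) ^ 2\<close> by metis
  then have "?P n = c ^ 2" using eq unfolding c by (simp add: power_mult_distrib)
  then show ?case by blast
qed

text \<open>The exponent \<open>e\<close> is the common multiplicity of the irreducible factors, and
  \<open>g\<close> is the squarefree part, whose prime factors all have rank
  \<open>m\<close>.\<close>

lemma reduce_fibotomic_root:
  fixes m :: nat
  assumes m: "m > 0" and cop: "coprime CARD('p::prime_card) m"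
  defines "e \<equiv> if CARD('p::prime_card) = 2 then 2 else 1"
  obtains g :: "'p::prime_card mod_ring poly" where "reduce_mod (fibotomic m) = g ^ e" "lead_coeff g = 1"
    "\<And>q. irreducible q \<Longrightarrow> \<not> q ^ 2 dvd g"
    "\<And>q n. irreducible q \<Longrightarrow> q dvd g \<Longrightarrow> q dvd fibo [:0, 1:] n \<longleftrightarrow> m dvd n"
proof -
  let ?P = "\<lambda>n. reduce_mod (fibotomic n) :: 'p mod_ring poly" and ?X = "[:0, 1 :: 'p mod_ring:]"
  have p: "prime CARD('p)" by (rule prime_card)
  have pe: "prime_elem q" if "irreducible q" for q :: "'p mod_ring poly"
    using that by (rule irreducible_imp_prime_elem)
  have fin: "finite {d. d dvd m}" using m by (simp add: finite_divisors_nat)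
  have pos: "n > 0" if "n dvd m" for n using that m by (auto intro: Nat.gr0I)
  show ?thesis
  proof (cases "CARD('p) = 2")
    case False
    then have odd: "odd CARD('p)" using p by (metis primes_dvd_imp_eq two_is_prime_nat)
    have prod: "(\<Prod>d | d dvd n. ?P d) = fibo ?X n" if "n dvd m" for n
      using prod_reduce_fibotomic pos[OF that] by blast
    have dvd: "?P m dvd fibo ?X m"
      unfolding prod[OF dvd_refl, symmetric] using fin by (intro dvd_prodI) auto
    have sq: "\<not> q ^ 2 dvd fibo ?X m" if "irreducible q" for q
      using dvd_fibo_odd_char(2)[OF pe[OF that] odd cop] dvd_trans[of q "q ^ 2"] by auto
    show ?thesis
    proof (rule that[of "?P m"])
      show "?P m = ?P m ^ e" using False by (simp add: e_def)
      show "lead_coeff (?P m) = 1" by (rule reduce_mod_monic(1)[OF fibotomic_monic])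
      show "\<not> q ^ 2 dvd ?P m" if "irreducible q" for q
        using sq[OF that] dvd dvd_trans by blast
      show "q dvd fibo ?X n \<longleftrightarrow> m dvd n" if "irreducible q" "q dvd ?P m" for q n
        by (rule primitive_factor_rank[OF pe[OF that(1)] m prod]) (use sq that in auto)
    qed
  next
    case True
    have ch: "CHAR('p mod_ring poly) = 2" using True by simp
    have oddm: "odd m" using cop True by simp
    have odd: "odd n" if "n dvd m" for n using oddm that by (auto intro: dvd_trans)
    have "\<forall>d. \<exists>h. d dvd m \<longrightarrow> ?P d = h ^ 2" using reduce_fibotomic_square[OF True] odd by blast
    then obtain h where h: "\<And>d. d dvd m \<Longrightarrow> ?P d = h d ^ 2" by metis
    have prod: "(\<Prod>d | d dvd n. h d) = fibo_sqrt ?X n" if "n dvd m" for n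
    proof -
      have "h d ^ 2 = ?P d" if "d dvd n" for d
        using h[OF dvd_trans[OF that \<open>n dvd m\<close>]] by simp
      then have "(\<Prod>d | d dvd n. h d) ^ 2 = (\<Prod>d | d dvd n. ?P d)"
        unfolding prod_power_distrib by (intro prod.cong) simp_all
      also have "\<dots> = fibo_sqrt ?X n ^ 2"
        using prod_reduce_fibotomic[OF pos[OF that]] fibo_sqrt_square[OF ch odd[OF that]] by metis
      finally show ?thesis unfolding char_two_facts(3)[OF ch] .
    qed
    have dvd: "h m dvd fibo_sqrt ?X m"
      unfolding prod[OF dvd_refl, symmetric] using fin by (intro dvd_prodI) auto
    have sq: "\<not> q ^ 2 dvd fibo_sqrt ?X m" if "irreducible q" for q
      by (rule fibo_sqrt_squarefree) (use True pe[OF that] in auto)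
    show ?thesis
    proof (rule that[of "h m"])
      show "?P m = h m ^ e" using True h[of m] by (simp add: e_def)
      \<comment> \<open>The chosen root is monic because squaring is injective in characteristic
        two.\<close>
      have "lead_coeff (h m) ^ 2 = 1"
        using reduce_mod_monic(1)[OF fibotomic_monic, of m, where 'p = 'p]
        unfolding h[OF dvd_refl] by (simp add: lead_coeff_power)
      then show "lead_coeff (h m) = 1"
        using char_two_facts(3)[where 'a = "'p mod_ring", of _ 1] True by simp
      show "\<not> q ^ 2 dvd h m" if "irreducible q" for q
        using sq[OF that] dvd dvd_trans by blast
      show "q dvd fibo ?X n \<longleftrightarrow> m dvd n" if q: "irreducible q" "q dvd h m" for q n
      proof (rule primitive_factor_rank[OF pe[OF q(1)] m prod])
        fix n assume "n dvd m"
        then show "q dvd fibo_sqrt ?X n \<longleftrightarrow> q dvd fibo ?X n"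
          using prime_elem_dvd_power_iff[OF pe[OF q(1)], of "fibo_sqrt ?X n" 2]
            fibo_sqrt_square[OF ch odd, of n ?X] by (metis zero_less_numeral)
      qed (use sq q in auto)
    qed
  qed
qed

section \<open>Degrees of the irreducible factors\<close>

text \<open>In \<open>F_(2 b) = F_b L_b\<close> the two factors cannot share \<open>q\<close>: it
  would divide \<open>2 F_(b+1)\<close>, hence two consecutive values.\<close>

lemma dvd_luc_iff:
  fixes x :: "'a::idom"
  assumes q: "prime_elem q" "\<not> q dvd 2" and rank: "\<And>n. q dvd fibo x n \<longleftrightarrow> m dvd n"
  shows "q dvd luc x b \<longleftrightarrow> m dvd 2 * b \<and> \<not> m dvd b"
proof -
  have "m dvd 2 * b \<longleftrightarrow> q dvd fibo x b \<or> q dvd luc x b"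
    unfolding rank[symmetric] fibo_even using q(1) by (rule prime_elem_dvd_mult_iff)
  moreover have "\<not> q dvd luc x b" if "q dvd fibo x b"
  proof
    assume "q dvd luc x b"
    then have "q dvd luc x b + x * fibo x b" using that by (intro dvd_add dvd_mult)
    then have "q dvd 2 * fibo x (Suc b)" by (simp add: luc_def)
    then have "q dvd fibo x (Suc b)" using q by (simp add: prime_elem_dvd_mult_iff)
    with that have "q dvd 1" by (rule fibo_consecutive)
    then show False using q(1) unfolding prime_elem_def by blast
  qed
  ultimately show ?thesis using rank by blast
qed

text \<open>Both sides say that \<open>2 * b\<close> is an odd multiple of \<open>m\<close>; the
  congruence matches the form of \<open>frob_cond\<close>.\<close>

lemma dvd_double_not_dvd_iff:
  fixes m b :: nat
  assumes "m > 0"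
  shows "m dvd 2 * b \<and> \<not> m dvd b \<longleftrightarrow> [2 * b = m] (mod 2 * m)"
proof
  assume *: "m dvd 2 * b \<and> \<not> m dvd b"
  then obtain c where c: "2 * b = m * c" by blast
  have "odd c"
  proof
    assume "even c"
    then obtain e where "c = 2 * e" by blast
    then have "b = m * e" using c by simp
    then show False using * by simp
  qed
  then obtain e where "c = 2 * e + 1" by (rule oddE)
  then have "2 * b = m + (2 * m) * e" using c by (simp add: algebra_simps)
  then show "[2 * b = m] (mod 2 * m)" by (simp add: cong_def)
next
  assume c: "[2 * b = m] (mod 2 * m)"
  have "[2 * b = m] (mod m)" using c by (rule cong_dvd_modulus_nat) simp
  then have 1: "m dvd 2 * b" by (simp add: cong_def dvd_eq_mod_eq_0)
  have "\<not> m dvd b"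
  proof
    assume "m dvd b"
    then have "2 * m dvd 2 * b" by (rule mult_dvd_mono[OF dvd_refl])
    then have "2 * m dvd m" using c by (simp add: cong_def dvd_eq_mod_eq_0)
    then show False using assms by (auto dest: dvd_imp_le)
  qed
  with 1 show "m dvd 2 * b \<and> \<not> m dvd b" ..
qed

section \<open>Frobenius congruences in terms of the rank\<close>

text \<open>The parity of \<open>a\<close>, that is \<open>s\<close> modulo 4, selects the product
  formula whose sign yields \<open>x^s - x\<close>.\<close>

lemma dvd_frobenius_iff_odd:
  fixes q :: "'p::prime_card mod_ring poly" and m d :: nat
  assumes q: "prime_elem q" and rank: "\<And>n. q dvd fibo [:0, 1:] n \<longleftrightarrow> m dvd n"
    and odd: "odd CARD('p)" and m: "m \<ge> 3" and cop: "coprime CARD('p) m"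
  shows "q dvd [:0, 1:] ^ (CARD('p) ^ d) - [:0, 1:] \<longleftrightarrow> frob_cond (CARD('p) ^ d) m"
proof -
  let ?X = "[:0, 1 :: 'p mod_ring:]"
  define s where "s = CARD('p) ^ d"
  define a where "a = s div 2"
  have p: "prime CARD('p)" by (rule prime_card)
  have "odd s" using odd by (simp add: s_def)
  then have s: "s = Suc (2 * a)" by (simp add: a_def)
  have L: "luc ?X s = ?X ^ s"
    using fibo_luc_char_power_odd(2)[of s d ?X] p odd by (simp add: s_def)
  have two: "\<not> q dvd 2"
    using dvd_of_nat_coprime_imp_unit[of q 2] q odd unfolding prime_elem_def by auto
  have "q dvd ?X ^ s - ?X \<longleftrightarrow> frob_cond s m"
  proof (cases "even a")
    case True
    \<comment> \<open>The factor \<open>x^2 + 4\<close> is harmless because \<open>q\<close> divides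
      \<open>F_m\<close> with \<open>m\<close> prime to \<open>p\<close>.\<close>
    have D: "\<not> q dvd ?X ^ 2 + 4"
      by (rule dvd_fibo_odd_char(1)[OF q odd cop]) (simp only: rank dvd_refl)
    have "?X ^ s - ?X = (?X ^ 2 + 4) * fibo ?X a * fibo ?X (Suc a)"
      unfolding L[symmetric] unfolding s luc_odd_fibo using True by (simp only: power_minus_even power_one) simp
    then have "q dvd ?X ^ s - ?X \<longleftrightarrow> m dvd a \<or> m dvd Suc a"
      using q D by (simp only: prime_elem_dvd_mult_iff rank) blast
    moreover have "[s = 1] (mod 2 * m) \<longleftrightarrow> m dvd a"
      unfolding s using cong_diff_iff_cong_0_nat[of 1 "Suc (2 * a)" "2 * m"] by (simp add: cong_0_iff)
    moreover have "[s + 1 = 0] (mod 2 * m) \<longleftrightarrow> m dvd Suc a"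
    proof -
      have "s + 1 = 2 * Suc a" by (simp add: s)
      then show ?thesis by (simp only: cong_0_iff nat_mult_dvd_cancel_disj) simp
    qed
    moreover have "s mod 4 = 1" unfolding s using True by presburger
    ultimately show ?thesis unfolding frob_cond_def by simp
  next
    case False
    have sgn: "(- 1 :: 'p mod_ring poly) ^ a = - 1" using False by simp
    have "?X ^ s - ?X = luc ?X a * luc ?X (Suc a)"
      unfolding L[symmetric] unfolding s luc_odd_luc sgn
      by (simp only: mult_minus1 diff_minus_eq_add add_diff_cancel_right')
    then have "q dvd ?X ^ s - ?X \<longleftrightarrow> [2 * a = m] (mod 2 * m) \<or> [2 * Suc a = m] (mod 2 * m)"
      using m
      by (simp only: prime_elem_dvd_mult_iff[OF q] dvd_luc_iff[OF q two rank] dvd_double_not_dvd_iff)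
    moreover have "[s = m + 1] (mod 2 * m) \<longleftrightarrow> [2 * a = m] (mod 2 * m)"
      unfolding s Suc_eq_plus1 by (rule cong_add_rcancel_nat)
    moreover have "[s = m - 1] (mod 2 * m) \<longleftrightarrow> [2 * Suc a = m] (mod 2 * m)"
      using cong_add_rcancel_nat[of s 1 "m - 1" "2 * m"] m unfolding s by simp
    moreover have "s mod 4 \<noteq> 1" unfolding s using False by presburger
    ultimately show ?thesis unfolding frob_cond_def by auto
  qed
  then show ?thesis by (simp add: s_def)
qed

text \<open>Squaring \<open>x^(2^d) - x\<close> doubles the index to \<open>2 * Suc n\<close> with
  \<open>n = 2^d - 1\<close>, so that \<open>luc_even\<close> factors it; a prime divides the square
  exactly when it divides the base.\<close>

lemma dvd_frobenius_iff_two: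
  fixes q :: "'p::prime_card mod_ring poly" and m d :: nat
  assumes q: "prime_elem q" and rank: "\<And>n. q dvd fibo [:0, 1:] n \<longleftrightarrow> m dvd n"
    and two: "CARD('p) = 2" and m: "m \<ge> 3"
  shows "q dvd [:0, 1:] ^ (2 ^ d) - [:0, 1:] \<longleftrightarrow> [2 ^ d = 1] (mod m) \<or> [2 ^ d + 1 = 0] (mod m)"
proof -
  let ?X = "[:0, 1 :: 'p mod_ring:]"
  have ch: "CHAR('p mod_ring poly) = 2" using two by simp
  note ct = char_two_facts[OF ch]
  have sub: "a - b = a + b" for a b :: "'p mod_ring poly"
    using ct(2)[of b] by (metis diff_conv_add_uminus)
  have four: "(4 :: 'p mod_ring poly) = 0"
    using ct(1) by (metis mult_zero_left numeral_Bit0 numeral_One mult_2 add_0)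
  define n where "n = 2 ^ d - (1 :: nat)"
  have n: "2 ^ d = Suc n" by (simp add: n_def)
  \<comment> \<open>\<open>F_2 = x\<close>, and \<open>m \<ge> 3\<close> does not divide 2.\<close>
  have X: "\<not> q dvd ?X"
    using rank[of 2] m by (auto simp: numeral_2_eq_2 dest: dvd_imp_le)
  have "(?X ^ (2 ^ d) - ?X) ^ 2 = ?X ^ (2 ^ Suc d) - ?X ^ 2"
    unfolding sub power2_sum by (simp add: ct(1) power_mult[symmetric] mult.commute)
  also have "?X ^ (2 ^ Suc d) = luc ?X (2 * Suc n)"
    using fibo_luc_char_power_two(3)[OF ch, of ?X "Suc d"] n by simp
  also have "luc ?X (2 * Suc n) = ?X ^ 2 * fibo ?X n * fibo ?X (Suc (Suc n)) + ?X ^ 2"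
    unfolding luc_even four ct(1) ct(2)[of 1] by simp
  also have "\<dots> - ?X ^ 2 = ?X ^ 2 * fibo ?X n * fibo ?X (Suc (Suc n))" by (rule add_diff_cancel_right')
  finally have eq: "(?X ^ (2 ^ d) - ?X) ^ 2 = ?X ^ 2 * fibo ?X n * fibo ?X (Suc (Suc n))" .
  have "q dvd ?X ^ (2 ^ d) - ?X \<longleftrightarrow> q dvd (?X ^ (2 ^ d) - ?X) ^ 2"
    using prime_elem_dvd_power_iff[OF q] by (metis zero_less_numeral)
  also have "\<dots> \<longleftrightarrow> m dvd n \<or> m dvd Suc (Suc n)"
    unfolding eq using X q by (simp only: prime_elem_dvd_mult_iff rank power2_eq_square) blast
  also have "m dvd n \<longleftrightarrow> [2 ^ d = 1] (mod m)"
    unfolding n using cong_diff_iff_cong_0_nat[of 1 "Suc n" m] by (simp add: cong_0_iff)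
  also have "m dvd Suc (Suc n) \<longleftrightarrow> [2 ^ d + 1 = 0] (mod m)"
    unfolding n by (simp add: cong_0_iff)
  finally show ?thesis .
qed

text \<open>Over the field with \<open>p\<close> elements, \<open>q\<close> divides
  \<open>x^(p^c) - x\<close> for \<open>c\<close> equal to its degree and for no smaller positive
  \<open>c\<close>.\<close>

lemma degree_irreducible_eq_least:
  fixes q :: "'p::prime_card mod_ring poly"
  assumes q: "irreducible q"
    and d: "d > 0" "q dvd [:0, 1:] ^ (CARD('p) ^ d) - [:0, 1:]"
    and least: "\<And>c. c > 0 \<Longrightarrow> q dvd [:0, 1:] ^ (CARD('p) ^ c) - [:0, 1:] \<Longrightarrow> d \<le> c"
  shows "degree q = d"
proof -
  have X: "Polynomial.monom 1 1 = [:0, 1 :: 'p mod_ring:]" by (simp add: monom_altdef)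
  have "\<not> is_unit q" "q \<noteq> 0" using q by (auto simp: irreducible_def)
  then have "degree q > 0" by (auto simp: is_unit_iff_degree)
  then have "d \<le> degree q" using degree_divisor(1)[OF q refl] least unfolding X by blast
  moreover have "\<not> d < degree q" using degree_divisor(2)[OF q refl, of d] d unfolding X by auto
  ultimately show ?thesis by simp
qed

text \<open>The number of factors comes from comparing degrees: \<open>totient m\<close> is
  \<open>e\<close> times the degree of the squarefree root, whose irreducible factors all have
  degree \<open>\<delta>\<close>.\<close>

lemma reduce_fibotomic_factorization:
  fixes m k \<delta> :: nat
  defines "e \<equiv> if CARD('p::prime_card) = 2 then 2 else 1"
  assumes m: "m \<ge> 3" and cop: "coprime CARD('p) m" and \<delta>: "\<delta> > 0"
    and degree: "\<And>q :: 'p mod_ring poly. irreducible q \<Longrightarrow>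
      (\<And>n. q dvd fibo [:0, 1:] n \<longleftrightarrow> m dvd n) \<Longrightarrow> degree q = \<delta>"
  shows "\<exists>Q. finite Q \<and> card Q = totient m div (e * \<delta>) \<and>
    (\<forall>q\<in>Q. irreducible q \<and> monic q \<and> degree q = \<delta>) \<and>
    (reduce_mod (fibotomic (CARD('p) ^ k * m)) :: 'p mod_ring poly)
      = (\<Prod>q\<in>Q. q ^ (e * totient (CARD('p) ^ k)))"
proof -
  have m0: "m > 0" using m by simp
  obtain g :: "'p mod_ring poly" where g: "reduce_mod (fibotomic m) = g ^ e" "lead_coeff g = 1"
    "\<And>q. irreducible q \<Longrightarrow> \<not> q ^ 2 dvd g"
    "\<And>q n. irreducible q \<Longrightarrow> q dvd g \<Longrightarrow> q dvd fibo [:0, 1:] n \<longleftrightarrow> m dvd n"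
    by (rule reduce_fibotomic_root[OF m0 cop, folded e_def], rule that)
  define Q where "Q = {q. lead_coeff q = 1 \<and> irreducible q \<and> q dvd g}"
  have fin: "finite Q" and gQ: "g = \<Prod>Q"
    unfolding Q_def using monic_squarefree_eq_prod[OF g(2)] g(3) by auto
  have Q: "irreducible q" "monic q" "degree q = \<delta>" if "q \<in> Q" for q
    using that degree[of q] g(4) by (auto simp: Q_def)
  have e: "e > 0" by (simp add: e_def)
  have g0: "g \<noteq> 0" using g(2) by auto
  have "totient m = degree (reduce_mod (fibotomic m) :: 'p mod_ring poly)"
    using reduce_mod_monic(2)[OF fibotomic_monic, of m, where 'p = 'p] degree_fibotomic[of m] m
    by simp
  also have "\<dots> = e * degree g" unfolding g(1) e_def using g0 by (simp add: power2_eq_square degree_mult_eq)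
  also have "degree g = (\<Sum>q\<in>Q. degree q)"
    unfolding gQ using Q(2) degree_prod_eq_sum_degree[of Q "\<lambda>q. q"]
    by (metis leading_coeff_0_iff zero_neq_one)
  also have "\<dots> = card Q * \<delta>" using Q(3) by simp
  finally have "card Q = totient m div (e * \<delta>)" using e \<delta> by simp
  moreover have "(reduce_mod (fibotomic (CARD('p) ^ k * m)) :: 'p mod_ring poly)
      = (\<Prod>q\<in>Q. q ^ (e * totient (CARD('p) ^ k)))"
    using reduce_fibotomic_prime_power_mult[OF cop, of k] m
    by (simp add: g(1) gQ prod_power_distrib power_mult)
  ultimately show ?thesis using fin Q by blast
qed

theorem mainTheorem17:
  fixes p m k n :: nat
  assumes p_def: "p = CARD('p::prime_card)"
    and m_pos: "m > 0" and cop: "coprime p m"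
    and n_def: "n = p ^ k * m" and n_ge: "n \<ge> 2"
  defines "Psi \<equiv> (reduce_mod (fibotomic n) :: 'p mod_ring poly)"
  shows
    "(m = 1 \<longrightarrow>
        (if p = 2 \<and> k = 1 then Psi = [:0, 1:]
         else Psi = [:4, 0, 1:] ^ (totient (p ^ k) div 2)))
   \<and> (m = 2 \<longrightarrow> Psi = [:0, 1:] ^ totient (p ^ k))
   \<and> (m \<ge> 3 \<and> p > 2 \<longrightarrow>
        (\<exists>Q. finite Q \<and> card Q = totient m div delta_odd p m \<and>
             (\<forall>q\<in>Q. irreducible q \<and> monic q \<and> degree q = delta_odd p m) \<and>
             Psi = (\<Prod>q\<in>Q. q ^ totient (p ^ k))))
   \<and> (m \<ge> 3 \<and> p = 2 \<longrightarrow>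
        (\<exists>Q. finite Q \<and> card Q = totient m div (2 * delta_two m) \<and>
             (\<forall>q\<in>Q. irreducible q \<and> monic q \<and> degree q = delta_two m) \<and>
             Psi = (\<Prod>q\<in>Q. q ^ (2 * totient (2 ^ k)))))"
proof (intro conjI impI)
  have p: "prime CARD('p)" by (rule prime_card)
  show "if p = 2 \<and> k = 1 then Psi = [:0, 1:] else Psi = [:4, 0, 1:] ^ (totient (p ^ k) div 2)"
    if "m = 1"
  proof -
    have k: "k > 0" using n_ge that by (cases k) (auto simp: n_def)
    have Psi: "Psi = reduce_mod (fibotomic (CARD('p) ^ k))"
      unfolding Psi_def n_def p_def using that by simp
    show ?thesis
    proof (cases "p = 2")
      case False
      then have "odd CARD('p)" using p p_def by (metis primes_dvd_imp_eq two_is_prime_nat)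
      then show ?thesis
        using reduce_fibotomic_prime_power_odd[OF _ k, where 'p = 'p] False Psi p_def by simp
    next
      case True
      then have two: "CARD('p) = 2" using p_def by simp
      have Psi2: "Psi = [:0, 1:] ^ totient (2 ^ k)"
        using reduce_fibotomic_prime_power_two[OF two k] Psi unfolding two by simp
      show ?thesis
      proof (cases "k = 1")
        case False
        \<comment> \<open>From \<open>k = 2\<close> on the totient of \<open>2^k\<close> is even and
          can be halved, and \<open>x^2 + 4\<close> is \<open>x^2\<close> because
          \<open>4 = 0\<close>.\<close>
        then have "k = Suc (Suc (k - 2))" using k by simp
        then obtain j where j: "k = Suc (Suc j)" by blast
        have tot: "totient (2 ^ k) = 2 * 2 ^ j"
          unfolding j using totient_prime_power_Suc[OF two_is_prime_nat, of "Suc j"] by simp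
        have "(4 :: 'p mod_ring) = of_nat 2 * 2" by simp
        also have "of_nat 2 = (0 :: 'p mod_ring)"
          using of_nat_CHAR[where 'a = "'p mod_ring"] two by simp
        finally have "[:4, 0, 1 :: 'p mod_ring:] = [:0, 1:] ^ 2" by (simp add: power2_eq_square)
        then have "Psi = [:4, 0, 1:] ^ (totient (p ^ k) div 2)"
          unfolding Psi2 True tot by (simp only: power_mult) simp
        then show ?thesis using False by simp
      qed (use Psi2 True in simp)
    qed
  qed
  show "Psi = [:0, 1:] ^ totient (p ^ k)" if "m = 2"
  proof -
    \<comment> \<open>The divisors 1 and 2 alone determine \<open>fibotomic 2\<close>, as
      \<open>F_2 = x\<close>.\<close>
    have "d = 1 \<or> d = 2" if "d dvd 2" for d :: nat
      using two_is_prime_nat that unfolding prime_nat_iff by blast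
    then have "{d. d dvd (2 :: nat)} = {1, 2}" by auto
    then have "fibotomic 1 * fibotomic 2 = fib_poly 2"
      using prod_fibotomic[of 2] by simp
    then have "fibotomic 2 = [:0, 1:]" by (simp add: fibotomic_def numeral_2_eq_2)
    then have 2: "reduce_mod (fibotomic 2) = [:0, 1 :: 'p mod_ring:]"
      by (simp only: reduce_mod_X)
    have "Psi = reduce_mod (fibotomic (CARD('p) ^ k * 2))"
      unfolding Psi_def n_def p_def that ..
    also have "\<dots> = reduce_mod (fibotomic 2) ^ totient (CARD('p) ^ k)"
      by (rule reduce_fibotomic_prime_power_mult) (use cop that p_def in auto)
    finally show ?thesis unfolding 2 p_def .
  qed
  show "\<exists>Q. finite Q \<and> card Q = totient m div delta_odd p m \<and>
      (\<forall>q\<in>Q. irreducible q \<and> monic q \<and> degree q = delta_odd p m) \<and>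
      Psi = (\<Prod>q\<in>Q. q ^ totient (p ^ k))" if m: "m \<ge> 3 \<and> p > 2"
  proof -
    have odd: "odd CARD('p)" using p p_def m by (metis less_irrefl primes_dvd_imp_eq two_is_prime_nat)
    have cop': "coprime CARD('p) m" using cop p_def by simp
    note \<delta> = delta_odd_least[of m p]
    have "degree q = delta_odd p m"
      if q: "irreducible q" "\<And>n. q dvd fibo [:0, 1:] n \<longleftrightarrow> m dvd n" for q :: "'p mod_ring poly"
    proof (rule degree_irreducible_eq_least[OF q(1)])
      note iff = dvd_frobenius_iff_odd[OF irreducible_imp_prime_elem[OF q(1)] q(2) odd _ cop']
      show "delta_odd p m > 0" using \<delta>(1) m odd cop p_def by simp
      show "q dvd [:0, 1:] ^ (CARD('p) ^ delta_odd p m) - [:0, 1:]"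
        using iff \<delta>(2) m odd cop p_def by simp
      show "delta_odd p m \<le> c" if "c > 0" "q dvd [:0, 1:] ^ (CARD('p) ^ c) - [:0, 1:]" for c
        using iff \<delta>(3)[of c] m odd cop p_def that by simp
    qed
    then show ?thesis
      using reduce_fibotomic_factorization[of m "delta_odd p m" k, where 'p = 'p]
        cop' m odd cop p_def \<delta>(1) unfolding Psi_def n_def by auto
  qed
  show "\<exists>Q. finite Q \<and> card Q = totient m div (2 * delta_two m) \<and>
      (\<forall>q\<in>Q. irreducible q \<and> monic q \<and> degree q = delta_two m) \<and>
      Psi = (\<Prod>q\<in>Q. q ^ (2 * totient (2 ^ k)))" if m: "m \<ge> 3 \<and> p = 2"
  proof -
    have two: "CARD('p) = 2" using m p_def by simp
    have cop': "coprime CARD('p) m" using cop p_def by simp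
    have oddm: "odd m" using cop m by simp
    note \<delta> = delta_two_least[of m]
    have "degree q = delta_two m"
      if q: "irreducible q" "\<And>n. q dvd fibo [:0, 1:] n \<longleftrightarrow> m dvd n" for q :: "'p mod_ring poly"
    proof (rule degree_irreducible_eq_least[OF q(1)])
      note iff = dvd_frobenius_iff_two[OF irreducible_imp_prime_elem[OF q(1)] q(2) two]
      show "delta_two m > 0" using \<delta>(1) m oddm by simp
      show "q dvd [:0, 1:] ^ (CARD('p) ^ delta_two m) - [:0, 1:]"
        using iff \<delta>(2) m oddm unfolding two by blast
      show "delta_two m \<le> c" if "c > 0" "q dvd [:0, 1:] ^ (CARD('p) ^ c) - [:0, 1:]" for c
        using iff \<delta>(3)[of c] m oddm that unfolding two by blast
    qed
    then show ?thesis
      using reduce_fibotomic_factorization[of m "delta_two m" k, where 'p = 'p]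
        cop' m oddm two \<delta>(1) p_def unfolding Psi_def n_def by auto
  qed
qed

end
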